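(* Let $\Gamma$ be a metrized graph with $v$ vertices and edge connectivity $\Lambda(\Gamma)$. Then: (1) If $\Lambda(\Gamma)\ge 4$, then $$\tau(\Gamma)\ \ge\ \ell(\Gamma)\Big(\frac{1}{12}\Big(1-\frac{4}{\Lambda(\Gamma)}\Big)^2+\frac{4(\Lambda(\Gamma)-2)}{(v+6)\Lambda(\Gamma)^2}\Big).$$ In particular, $\tau(\Gamma)\ge \frac{\ell(\Gamma)}{108}$ if $\Lambda(\Gamma)\ge 6$, and $\tau(\Gamma)\ge\frac{\ell(\Gamma)}{300}$ if $\Lambda(\Gamma)=5$. (2) $\tau(\Gamma)\ge \frac{\ell(\Gamma)}{2(v+6)}$. In particular, $\tau(\Gamma)\ge\frac{\ell(\Gamma)}{108}$ if $v\le 48$.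
   Context: A metrized graph $\Gamma$ is a finite connected graph (multiple edges and self-loops allowed) in which each edge $e_i$ is identified with a closed line segment of some length $L_i>0$. A vertex set $V(\Gamma)$ is a finite nonempty set of points of $\Gamma$ containing every point whose valence (number of directions emanating from it) is not $2$; the edges are the closed segments between vertices, $v=\#V(\Gamma)$, and $\ell(\Gamma)=\sum_i L_i$ is the total length. The edge connectivity $\Lambda(\Gamma)$ is the minimum number of edges whose deletion disconnects $\Gamma$. Let $r(x,y)$ be the effective resistance between $x,y\in\Gamma$ when $\Gamma$ is viewed as an electric circuit in which each edge has resistance equal to its length. The tau constant is $\tau(\Gamma)=\frac14\int_\Gamma\big(\frac{\partial}{\partial x}r(x,y)\big)^2dx$, which is independent of the choice of $y\in\Gamma$ (equivalently, it is half the constant diagonal value $j_{\mu_{can}}(x,x)$ for the Chinburg–Rumely canonical measure). *)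

theory Defs
  imports
    "HOL-Analysis.Analysis"
    "HOL-Library.Extended_Nat"
    "Graph_Theory.Digraph_Component"
begin

text \<open>
  A metrized graph with a chosen vertex set is a finite connected multigraph (self-loops and
  multiple edges allowed) with positive edge lengths.  The arcs carry an arbitrary orientation:
  it fixes the identification of the edge \<open>e\<close> with the segment \<open>[0, len e]\<close>, where \<open>0\<close> is glued to
  \<open>tail G e\<close> and \<open>len e\<close> to \<open>head G e\<close>.  The interior points of edges have valence 2, so every
  point of another valence is a vertex; vertices of valence 2 are allowed.  The predicate
  \<open>Digraph_Component.connected\<close> ignores the orientation and implies that there is a vertex.
\<close>

locale metrized_graph = fin_digraph G
  for G :: "('a, 'b) pre_digraph" +
  fixes len :: "'b \<Rightarrow> real"
  assumes connected_graph: "Digraph_Component.connected G"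
    and len_pos: "e \<in> arcs G \<Longrightarrow> 0 < len e"

definition total_length :: "('a, 'b) pre_digraph \<Rightarrow> ('b \<Rightarrow> real) \<Rightarrow> real" where
  "total_length G len = (\<Sum>e\<in>arcs G. len e)"

text \<open>
  The infimum in \<open>enat\<close> is attained unless the set is empty.  For a connected graph this happens
  exactly if there is only one vertex, and then the value is \<open>\<infinity>\<close>.
\<close>

definition edge_connectivity :: "('a, 'b) pre_digraph \<Rightarrow> enat" where
  "edge_connectivity G =
     Inf {enat (card F) | F. F \<subseteq> arcs G \<and> finite F \<and>
            \<not> Digraph_Component.connected (G\<lparr>arcs := arcs G - F\<rparr>)}"


datatype ('a, 'b) mg_point = Vertex 'a | Inner 'b real

definition points :: "('a, 'b) pre_digraph \<Rightarrow> ('b \<Rightarrow> real) \<Rightarrow> ('a, 'b) mg_point set" where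
  "points G len = Vertex ` verts G \<union> {Inner e t | e t. e \<in> arcs G \<and> 0 < t \<and> t < len e}"

definition edge_point ::
    "('a, 'b) pre_digraph \<Rightarrow> ('b \<Rightarrow> real) \<Rightarrow> 'b \<Rightarrow> real \<Rightarrow> ('a, 'b) mg_point" where
  "edge_point G len e t =
     (if t = 0 then Vertex (tail G e) else if t = len e then Vertex (head G e) else Inner e t)"

text \<open>
  Adding a finite set \<open>P\<close> of points to the vertex set: the arc \<open>(e, a, b)\<close> is the segment of \<open>e\<close>
  between the consecutive division points \<open>a < b\<close>.
\<close>

definition cuts :: "('b \<Rightarrow> real) \<Rightarrow> ('a, 'b) mg_point set \<Rightarrow> 'b \<Rightarrow> real set" where
  "cuts len P e = {0, len e} \<union> {t. Inner e t \<in> P}"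

definition refine ::
    "('a, 'b) pre_digraph \<Rightarrow> ('b \<Rightarrow> real) \<Rightarrow> ('a, 'b) mg_point set \<Rightarrow>
     (('a, 'b) mg_point, 'b \<times> real \<times> real) pre_digraph" where
  "refine G len P =
     \<lparr> verts = Vertex ` verts G \<union> P,
       arcs = {(e, a, b). e \<in> arcs G \<and> a \<in> cuts len P e \<and> b \<in> cuts len P e \<and> a < b \<and>
                          cuts len P e \<inter> {a<..<b} = {}},
       tail = (\<lambda>(e, a, b). edge_point G len e a),
       head = (\<lambda>(e, a, b). edge_point G len e b) \<rparr>"

definition segment_length :: "'b \<times> real \<times> real \<Rightarrow> real" where
  "segment_length = (\<lambda>(e, a, b). b - a)"


text \<open>
  Electric circuits in which the arc \<open>a\<close> has resistance \<open>R a\<close>.  By Ohm's law, the current leaving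
  \<open>tail G a\<close> through \<open>a\<close> is \<open>(f (tail G a) - f (head G a)) / R a\<close>.  The potential \<open>f\<close> satisfies
  Kirchhoff's current law when a unit current enters the circuit at \<open>x\<close> and leaves it at \<open>y\<close>.
\<close>

definition unit_current_potential ::
    "('v, 'e) pre_digraph \<Rightarrow> ('e \<Rightarrow> real) \<Rightarrow> 'v \<Rightarrow> 'v \<Rightarrow> ('v \<Rightarrow> real) \<Rightarrow> bool" where
  "unit_current_potential G R x y f \<longleftrightarrow>
     (\<forall>p\<in>verts G.
        (\<Sum>a\<in>out_arcs G p. (f p - f (head G a)) / R a) +
        (\<Sum>a\<in>in_arcs G p. (f p - f (tail G a)) / R a) =
        (if p = x then 1 else 0) - (if p = y then 1 else 0))"

text \<open>
  In a finite connected circuit the potential exists and is unique up to an additive constant on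
  the vertices, so the potential difference below is well defined.
\<close>

definition effective_resistance ::
    "('v, 'e) pre_digraph \<Rightarrow> ('e \<Rightarrow> real) \<Rightarrow> 'v \<Rightarrow> 'v \<Rightarrow> real" where
  "effective_resistance G R x y =
     (THE r. \<exists>f. unit_current_potential G R x y f \<and> r = f x - f y)"

definition resistance ::
    "('a, 'b) pre_digraph \<Rightarrow> ('b \<Rightarrow> real) \<Rightarrow> ('a, 'b) mg_point \<Rightarrow> ('a, 'b) mg_point \<Rightarrow> real" where
  "resistance G len x y = effective_resistance (refine G len {x, y}) segment_length x y"

text \<open>
  The tau constant computed with the base point \<open>y\<close>; the value is the same for all points \<open>y\<close> of
  the metrized graph.  The derivative fails to exist in at most one interior point of an edge,
  namely \<open>y\<close>, and the values of the integrand at the end points are irrelevant.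
\<close>

definition tau ::
    "('a, 'b) pre_digraph \<Rightarrow> ('b \<Rightarrow> real) \<Rightarrow> ('a, 'b) mg_point \<Rightarrow> real" where
  "tau G len y =
     1 / 4 * (\<Sum>e\<in>arcs G.
       integral {0..len e} (\<lambda>t. (deriv (\<lambda>s. resistance G len (edge_point G len e s) y) t)\<^sup>2))"

end

theory Submission
  imports Defs
begin

text \<open>
  Let \<open>\<rho>\<^sub>e = r\<^sub>e / L\<^sub>e\<close>, where \<open>r\<^sub>e\<close> is the resistance between the ends of the edge \<open>e\<close>, and let
  \<open>S = \<Sum> r\<^sub>e\<close>, \<open>B = \<Sum> r\<^sub>e\<^sup>2 / L\<^sub>e\<close> and \<open>E\<close> the Dirichlet energy of \<open>r(\<cdot>, y)\<close> on the vertices, which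
  does not depend on \<open>y\<close>.  Then \<open>\<tau> = (\<ell> - 2 S + B) / 12 + E / 4\<close>.  Averaging over the vertices
  \<open>y\<close> gives \<open>E \<ge> 2 B / v\<close>, and \<open>B \<ge> S\<^sup>2 / \<ell>\<close> by Cauchy-Schwarz; this proves the second bound.  Both
  \<open>S\<close> and \<open>Q = (B + 3 E) / 4\<close> satisfy the contraction identity
  \<open>(v - 2) F(\<Gamma>) = \<Sum> \<rho>\<^sub>e F(\<Gamma> / e)\<close>, and contraction does not decrease the edge connectivity, so
  \<open>\<Lambda> Q \<le> S\<close> follows from the case of two vertices.  Combined with \<open>Q \<ge> (v + 6) S\<^sup>2 / (4 v \<ell>)\<close> it
  bounds \<open>S\<close> by \<open>4 v \<ell> / ((v + 6) \<Lambda>)\<close>, which yields the first bound.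
\<close>

section \<open>Grounded electric networks\<close>

text \<open>The Dirichlet form with conductance 1 / L e on the edge e. Edge set and end maps are
  separate arguments, so that a contraction keeps all edges and changes only their ends.\<close>

definition energy ::
    "'e set \<Rightarrow> ('e \<Rightarrow> 'v) \<Rightarrow> ('e \<Rightarrow> 'v) \<Rightarrow> ('e \<Rightarrow> real) \<Rightarrow> ('v \<Rightarrow> real) \<Rightarrow> ('v \<Rightarrow> real) \<Rightarrow> real" where
  "energy A t h L \<phi> \<psi> = (\<Sum>e\<in>A. (\<phi> (t e) - \<phi> (h e)) * (\<psi> (t e) - \<psi> (h e)) / L e)"

lemma energy_commute: "energy A t h L \<phi> \<psi> = energy A t h L \<psi> \<phi>"
  unfolding energy_def by (intro sum.cong) auto

lemma energy_linear_right:
  "energy A t h L \<phi> (\<lambda>x. a * \<psi> x + b * \<omega> x) = a * energy A t h L \<phi> \<psi> + b * energy A t h L \<phi> \<omega>"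
  unfolding energy_def sum_distrib_left sum.distrib [symmetric]
  by (intro sum.cong) (auto simp: algebra_simps add_divide_distrib diff_divide_distrib)

lemma energy_linear_left:
  "energy A t h L (\<lambda>x. a * \<psi> x + b * \<omega> x) \<phi> = a * energy A t h L \<psi> \<phi> + b * energy A t h L \<omega> \<phi>"
  by (metis energy_commute energy_linear_right)

lemma energy_diff_left:
  "energy A t h L (\<lambda>x. \<psi> x - \<omega> x) \<phi> = energy A t h L \<psi> \<phi> - energy A t h L \<omega> \<phi>"
  using energy_linear_left [of A t h L 1 \<psi> "-1" \<omega> \<phi>] by simp

lemma energy_diff_scaled:
  "energy A t h L (\<lambda>x. \<phi> x - c * \<psi> x) (\<lambda>x. \<phi> x - c * \<psi> x)
    = energy A t h L \<phi> \<phi> - 2 * c * energy A t h L \<phi> \<psi> + c\<^sup>2 * energy A t h L \<psi> \<psi>"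
proof -
  have right: "energy A t h L \<omega> (\<lambda>x. \<phi> x - c * \<psi> x) = energy A t h L \<omega> \<phi> - c * energy A t h L \<omega> \<psi>" for \<omega>
    using energy_linear_right [of A t h L \<omega> 1 \<phi> "- c" \<psi>] by simp
  have left: "energy A t h L (\<lambda>x. \<phi> x - c * \<psi> x) \<omega> = energy A t h L \<phi> \<omega> - c * energy A t h L \<psi> \<omega>"
    for \<omega>
    using energy_linear_left [of A t h L 1 \<phi> "- c" \<psi> \<omega>] by simp
  show ?thesis
    unfolding right left energy_commute [of A t h L \<psi> \<phi>]
    by (simp add: algebra_simps power2_eq_square)
qed

lemma energy_cong:
  assumes "\<And>e. e \<in> A \<Longrightarrow> \<phi> (t e) - \<phi> (h e) = \<phi>' (t' e) - \<phi>' (h' e)"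
    and "\<And>e. e \<in> A \<Longrightarrow> \<psi> (t e) - \<psi> (h e) = \<psi>' (t' e) - \<psi>' (h' e)"
  shows "energy A t h L \<phi> \<psi> = energy A t' h' L \<phi>' \<psi>'"
  unfolding energy_def using assms by (intro sum.cong) auto

text \<open>
  \<open>K x\<close> is the potential for a unit current from \<open>x\<close> to the grounded vertex; Kirchhoff's law is
  stated in its weak form, so that identifying vertices amounts to restricting the test
  functions.
\<close>

locale grounded_network =
  fixes A :: "'e set" and V :: "'v set" and t h :: "'e \<Rightarrow> 'v" and L :: "'e \<Rightarrow> real"
    and ground :: 'v and K :: "'v \<Rightarrow> 'v \<Rightarrow> real"
  assumes finite_edges: "finite A" and finite_vertices: "finite V"
    and tail_mem: "e \<in> A \<Longrightarrow> t e \<in> V" and head_mem: "e \<in> A \<Longrightarrow> h e \<in> V"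
    and length_pos: "e \<in> A \<Longrightarrow> 0 < L e"
    and ground_mem: "ground \<in> V"
    and K_ground: "x \<in> V \<Longrightarrow> K x ground = 0"
    and energy_K: "x \<in> V \<Longrightarrow> energy A t h L (K x) \<phi> = \<phi> x - \<phi> ground"
begin

section \<open>Resistances across edges, reciprocity and Foster's theorem\<close>

abbreviation "dir \<equiv> energy A t h L"

text \<open>\<open>diag x\<close> is the resistance between x and the ground.
  \<open>edge_potential e\<close> is the potential of a unit current from tail to head of e, and
  \<open>transfer e f\<close> the voltage it causes across f. So \<open>transfer e e\<close> is the
  resistance between the ends of e.\<close>

definition diag :: "'v \<Rightarrow> real" where "diag x = K x x"
definition edge_potential :: "'e \<Rightarrow> 'v \<Rightarrow> real" where
  "edge_potential e x = K (t e) x - K (h e) x"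
definition transfer :: "'e \<Rightarrow> 'e \<Rightarrow> real" where
  "transfer e f = edge_potential e (t f) - edge_potential e (h f)"

definition res_sum :: real where "res_sum = (\<Sum>e\<in>A. transfer e e)"
definition res_square_sum :: real where "res_square_sum = (\<Sum>e\<in>A. (transfer e e)\<^sup>2 / L e)"
definition diag_energy :: real where "diag_energy = dir diag diag"

text \<open>Reciprocity: test each of the two potentials against the other.\<close>

lemma K_commute: "x \<in> V \<Longrightarrow> y \<in> V \<Longrightarrow> K x y = K y x"
  using energy_K [of x "K y"] energy_K [of y "K x"] K_ground energy_commute [of A t h L "K x" "K y"]
  by simp

lemma K_ground_left: "y \<in> V \<Longrightarrow> K ground y = 0"
  using K_commute [of ground y] ground_mem K_ground by simp

lemma transfer_commute: "e \<in> A \<Longrightarrow> f \<in> A \<Longrightarrow> transfer e f = transfer f e"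
  unfolding transfer_def edge_potential_def
  using K_commute tail_mem head_mem by (smt (verit))

lemma edge_potential_ground: "e \<in> A \<Longrightarrow> edge_potential e ground = 0"
  unfolding edge_potential_def using K_ground tail_mem head_mem by simp

lemma energy_edge_potential: "e \<in> A \<Longrightarrow> dir (edge_potential e) \<phi> = \<phi> (t e) - \<phi> (h e)"
  unfolding edge_potential_def energy_diff_left
  using energy_K tail_mem head_mem by simp

text \<open>By reciprocity \<open>edge_potential f x\<close> is the voltage of \<open>K x\<close>
  across f, so both sides are the power dissipated by the unit current from x to the ground.\<close>

lemma sum_edge_potential_square:
  assumes "x \<in> V"
  shows "(\<Sum>f\<in>A. (edge_potential f x)\<^sup>2 / L f) = diag x"
proof -
  have "(\<Sum>f\<in>A. (edge_potential f x)\<^sup>2 / L f) = dir (K x) (K x)"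
    unfolding energy_def
    by (intro sum.cong)
       (auto simp: edge_potential_def power2_eq_square K_commute [OF assms] tail_mem head_mem)
  also have "\<dots> = diag x"
    using energy_K [OF assms] K_ground [OF assms] by (simp add: diag_def)
  finally show ?thesis .
qed

lemma sum_transfer_square:
  assumes "e \<in> A"
  shows "(\<Sum>f\<in>A. (transfer e f)\<^sup>2 / L f) = transfer e e"
proof -
  have "(\<Sum>f\<in>A. (transfer e f)\<^sup>2 / L f) = dir (edge_potential e) (edge_potential e)"
    unfolding energy_def transfer_def by (simp add: power2_eq_square)
  then show ?thesis
    using energy_edge_potential [OF assms] by (simp add: transfer_def)
qed

lemma transfer_self_nonneg: "e \<in> A \<Longrightarrow> 0 \<le> transfer e e"
  using sum_transfer_square [of e] length_pos
  by (metis (no_types, lifting) divide_nonneg_pos sum_nonneg zero_le_power2)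

lemma transfer_eq_0:
  assumes "e \<in> A" "f \<in> A" "transfer e e = 0"
  shows "transfer e f = 0"
proof -
  have "\<forall>f\<in>A. (transfer e f)\<^sup>2 / L f = 0"
    using sum_transfer_square [OF assms(1)] assms(3) finite_edges
      sum_nonneg_eq_0_iff [of A "\<lambda>f. (transfer e f)\<^sup>2 / L f"] length_pos less_imp_le
    by (simp add: less_imp_le)
  then show ?thesis
    using assms(2) length_pos [of f] by auto
qed

lemma loop_transfer: "t e = h e \<Longrightarrow> transfer f e = 0"
  by (simp add: transfer_def)

text \<open>Foster's theorem. Testing \<open>K x\<close> against the indicator of x gives 1, or 0 at
  the ground; exchanging the sums over x and over the edges leaves the resistances across the
  edges.\<close>

lemma foster: "(\<Sum>e\<in>A. transfer e e / L e) = real (card V) - 1"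
proof -
  have "(\<Sum>e\<in>A. transfer e e / L e)
      = (\<Sum>e\<in>A. \<Sum>x\<in>V. (K x (t e) - K x (h e)) * (of_bool (t e = x) - of_bool (h e = x)) / L e)"
  proof (intro sum.cong refl)
    fix e assume e: "e \<in> A"
    have *: "(\<Sum>x\<in>V. (K x (t e) - K x (h e)) * of_bool (y = x)) = K y (t e) - K y (h e)"
      if "y \<in> V" for y
      using that finite_vertices by (simp add: sum.delta' of_bool_def if_distrib cong: if_cong)
    have "(\<Sum>x\<in>V. (K x (t e) - K x (h e)) * (of_bool (t e = x) - of_bool (h e = x)) / L e)
        = ((\<Sum>x\<in>V. (K x (t e) - K x (h e)) * of_bool (t e = x))
           - (\<Sum>x\<in>V. (K x (t e) - K x (h e)) * of_bool (h e = x))) / L e"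
      unfolding sum_divide_distrib [symmetric] sum_subtractf [symmetric]
      by (simp only: right_diff_distrib)
    also have "\<dots> = transfer e e / L e"
      using * [OF tail_mem [OF e]] * [OF head_mem [OF e]]
      by (simp add: transfer_def edge_potential_def)
    finally show "transfer e e / L e
      = (\<Sum>x\<in>V. (K x (t e) - K x (h e)) * (of_bool (t e = x) - of_bool (h e = x)) / L e)" ..
  qed
  also have "\<dots> = (\<Sum>x\<in>V. dir (K x) (\<lambda>y. of_bool (y = x)))"
    unfolding energy_def by (rule sum.swap)
  also have "\<dots> = (\<Sum>x\<in>V. 1 - of_bool (x = ground))"
    by (intro sum.cong) (auto simp: energy_K)
  also have "\<dots> = real (card V) - (\<Sum>x\<in>V. if x = ground then 1 else 0)"
    by (simp only: sum_subtractf of_bool_def) simp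
  also have "\<dots> = real (card V) - 1"
    using finite_vertices ground_mem by (simp add: sum.delta)
  finally show ?thesis .
qed

text \<open>Up to the constant \<open>K y y\<close>, the function is the resistance from y. Testing
  \<open>K y\<close> against \<open>diag\<close> and against itself gives \<open>diag y\<close> both
  times, so the terms depending on y cancel.\<close>

lemma energy_resistance_from:
  assumes "y \<in> V"
  shows "dir (\<lambda>x. diag x - 2 * K y x) (\<lambda>x. diag x - 2 * K y x) = diag_energy"
proof -
  have "dir diag (K y) = diag y" "dir (K y) diag = diag y" "dir (K y) (K y) = diag y"
    using energy_K [OF assms] K_ground [OF assms] K_ground [OF ground_mem]
    by (simp_all add: energy_commute [of A t h L diag] diag_def)
  then show ?thesis
    using energy_diff_scaled [of A t h L diag 2 "K y"] by (simp add: diag_energy_def)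
qed

text \<open>Sum the previous identity over \<open>y\<close> and keep, for each edge, only its two ends.\<close>

lemma diag_energy_ge: "2 * res_square_sum \<le> real (card V) * diag_energy"
proof -
  let ?d = "\<lambda>y e. (diag (t e) - 2 * K y (t e)) - (diag (h e) - 2 * K y (h e))"
  have "real (card V) * diag_energy = (\<Sum>y\<in>V. \<Sum>e\<in>A. (?d y e)\<^sup>2 / L e)"
    using energy_resistance_from by (simp add: energy_def power2_eq_square)
  also have "\<dots> = (\<Sum>e\<in>A. \<Sum>y\<in>V. (?d y e)\<^sup>2 / L e)"
    by (rule sum.swap)
  also have "\<dots> \<ge> (\<Sum>e\<in>A. 2 * ((transfer e e)\<^sup>2 / L e))"
  proof (rule sum_mono)
    fix e assume e: "e \<in> A"
    show "2 * ((transfer e e)\<^sup>2 / L e) \<le> (\<Sum>y\<in>V. (?d y e)\<^sup>2 / L e)"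
    proof (cases "t e = h e")
      case True
      then show ?thesis
        using loop_transfer [of e e] by simp
    next
      case False
      \<comment> \<open>The resistance from y vanishes at y, so for an end y of e its difference
        across e is plus or minus the resistance of e.\<close>
      have "?d (t e) e = - transfer e e" "?d (h e) e = transfer e e"
        using K_commute [OF tail_mem [OF e] head_mem [OF e]]
        by (auto simp: diag_def transfer_def edge_potential_def)
      then have "2 * ((transfer e e)\<^sup>2 / L e) = (\<Sum>y\<in>{t e, h e}. (?d y e)\<^sup>2 / L e)"
        using False by simp
      also have "\<dots> \<le> (\<Sum>y\<in>V. (?d y e)\<^sup>2 / L e)"
        using e by (intro sum_mono2) (auto simp: finite_vertices tail_mem head_mem length_pos less_imp_le)
      finally show ?thesis .
    qed
  qed
  finally show ?thesis
    by (simp add: res_square_sum_def sum_distrib_left)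
qed

lemma res_sum_square_le: "res_sum\<^sup>2 \<le> (\<Sum>e\<in>A. L e) * res_square_sum"
proof -
  have "(\<Sum>e\<in>A. sqrt (L e) * (transfer e e / sqrt (L e)))\<^sup>2
      \<le> (\<Sum>e\<in>A. (sqrt (L e))\<^sup>2) * (\<Sum>e\<in>A. (transfer e e / sqrt (L e))\<^sup>2)"
    by (rule Cauchy_Schwarz_ineq_sum)
  also have "(\<Sum>e\<in>A. sqrt (L e) * (transfer e e / sqrt (L e))) = res_sum"
    unfolding res_sum_def by (intro sum.cong) (auto dest: length_pos)
  also have "(\<Sum>e\<in>A. (sqrt (L e))\<^sup>2) = (\<Sum>e\<in>A. L e)"
    by (intro sum.cong) (auto dest: length_pos)
  also have "(\<Sum>e\<in>A. (transfer e e / sqrt (L e))\<^sup>2) = res_square_sum"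
    unfolding res_square_sum_def by (intro sum.cong) (auto dest: length_pos simp: power_divide)
  finally show ?thesis .
qed

end

section \<open>Contraction\<close>

context grounded_network
begin

text \<open>If the resistance across e vanishes, no voltage appears anywhere; testing against the
  indicator of one end then forces the ends to coincide.\<close>

lemma transfer_self_eq_0_iff:
  assumes "e \<in> A"
  shows "transfer e e = 0 \<longleftrightarrow> t e = h e"
proof
  assume "transfer e e = 0"
  then have "transfer e f = 0" if "f \<in> A" for f
    using transfer_eq_0 [OF assms that] by simp
  then have "dir (edge_potential e) (\<lambda>x. of_bool (x = t e)) = 0"
    by (simp add: energy_def transfer_def)
  then show "t e = h e"
    using energy_edge_potential [OF assms] by (auto split: if_splits)
qed (simp add: loop_transfer)

lemma edge_potential_loop: "t e = h e \<Longrightarrow> edge_potential e x = 0"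
  by (simp add: edge_potential_def)

text \<open>The multiple of \<open>edge_potential f\<close> is chosen so that the voltage across f
  becomes 0.\<close>

definition contracted :: "'e \<Rightarrow> 'v \<Rightarrow> 'v \<Rightarrow> real" where
  "contracted f x y = K x y - edge_potential f x * edge_potential f y / transfer f f"

text \<open>The map \<sigma> merges d into the other end of f, and f stays in the network as a loop.
  Test functions composed with \<sigma> do not separate the ends of f, so the energy of the
  correction term against them is 0 and the weak Kirchhoff law survives.\<close>

lemma contraction:
  assumes f: "f \<in> A" and not_loop: "t f \<noteq> h f"
  obtains d \<sigma> where "d \<in> V" "\<And>x. x \<in> V \<Longrightarrow> \<sigma> x \<in> V - {d}" "\<And>x. x \<in> V - {d} \<Longrightarrow> \<sigma> x = x"
    "\<And>x y. x \<in> V \<Longrightarrow> y \<in> V \<Longrightarrow> contracted f (\<sigma> x) (\<sigma> y) = contracted f x y"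
    "grounded_network A (V - {d}) (\<sigma> \<circ> t) (\<sigma> \<circ> h) L ground (contracted f)"
proof -
  \<comment> \<open>The deleted end must not be the ground.\<close>
  define d where "d = (if h f = ground then t f else h f)"
  define k where "k = (if h f = ground then h f else t f)"
  define \<sigma> where "\<sigma> x = (if x = d then k else x)" for x
  have dk: "{d, k} = {t f, h f}" "d \<noteq> k" "d \<noteq> ground" "d \<in> V" "k \<in> V"
    using not_loop tail_mem [OF f] head_mem [OF f] by (auto simp: d_def k_def)
  have r: "transfer f f \<noteq> 0"
    using transfer_self_eq_0_iff f not_loop by simp
  have flat: "contracted f x (t f) = contracted f x (h f)" if "x \<in> V" for x
  proof -
    have "K x (t f) - K x (h f) = edge_potential f x"
      using that f by (simp add: edge_potential_def K_commute tail_mem head_mem)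
    then show ?thesis
      using r by (simp add: contracted_def field_simps) (simp add: transfer_def algebra_simps)
  qed
  have commute: "contracted f x y = contracted f y x" if "x \<in> V" "y \<in> V" for x y
    using that K_commute by (simp add: contracted_def)
  have \<sigma>_right: "contracted f x (\<sigma> y) = contracted f x y" if "x \<in> V" for x y
    using flat [OF that] dk(1) by (auto simp: \<sigma>_def doubleton_eq_iff)
  have \<sigma>_mem: "\<sigma> x \<in> V - {d}" if "x \<in> V" for x
    using that dk by (auto simp: \<sigma>_def)
  have \<sigma>_both: "contracted f (\<sigma> x) (\<sigma> y) = contracted f x y" if "x \<in> V" "y \<in> V" for x y
    using that \<sigma>_right \<sigma>_mem commute by (metis DiffD1)
  have \<sigma>_ends: "\<sigma> (t f) = \<sigma> (h f)"
    using dk by (auto simp: \<sigma>_def doubleton_eq_iff)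
  have "grounded_network A (V - {d}) (\<sigma> \<circ> t) (\<sigma> \<circ> h) L ground (contracted f)"
  proof
    show "energy A (\<sigma> \<circ> t) (\<sigma> \<circ> h) L (contracted f x) \<phi> = \<phi> x - \<phi> ground"
      if x: "x \<in> V - {d}" for x \<phi>
    proof -
      have "energy A (\<sigma> \<circ> t) (\<sigma> \<circ> h) L (contracted f x) \<phi> = dir (contracted f x) (\<phi> \<circ> \<sigma>)"
        using x \<sigma>_right by (intro energy_cong) auto
      also have "\<dots> = dir (K x) (\<phi> \<circ> \<sigma>)
          - edge_potential f x / transfer f f * dir (edge_potential f) (\<phi> \<circ> \<sigma>)"
        using energy_linear_left [of A t h L 1 "K x" "- (edge_potential f x / transfer f f)"
            "edge_potential f" "\<phi> \<circ> \<sigma>"]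
        by (simp add: contracted_def [abs_def])
      also have "\<dots> = \<phi> x - \<phi> ground"
        using x energy_K energy_edge_potential [OF f] \<sigma>_ends dk(3) by (simp add: \<sigma>_def)
      finally show ?thesis .
    qed
  qed (use finite_edges finite_vertices \<sigma>_mem tail_mem head_mem length_pos ground_mem dk
      K_ground edge_potential_ground [OF f] in \<open>auto simp: contracted_def\<close>)
  with that [of d \<sigma>] dk \<sigma>_mem \<sigma>_both show ?thesis
    by (simp add: \<sigma>_def)
qed

text \<open>This and the next two are the parameters of the network with f contracted, expressed in
  the original one; see \<open>contracted_parameters\<close>. For a loop f the division by 0 is
  harmless, as the weight \<open>transfer f f / L f\<close> vanishes.\<close>

definition contracted_res_sum :: "'e \<Rightarrow> real" where
  "contracted_res_sum f = (\<Sum>e\<in>A. transfer e e - (transfer f e)\<^sup>2 / transfer f f)"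

definition contracted_res_square_sum :: "'e \<Rightarrow> real" where
  "contracted_res_square_sum f =
    (\<Sum>e\<in>A. (transfer e e - (transfer f e)\<^sup>2 / transfer f f)\<^sup>2 / L e)"

definition contracted_diag_energy :: "'e \<Rightarrow> real" where
  "contracted_diag_energy f =
    dir (\<lambda>x. diag x - (edge_potential f x)\<^sup>2 / transfer f f)
        (\<lambda>x. diag x - (edge_potential f x)\<^sup>2 / transfer f f)"

text \<open>The remainder that enters the averages of \<open>contracted_res_square_sum\<close> and
  of three times \<open>contracted_diag_energy\<close> with opposite signs.\<close>

definition quartic :: "'e \<Rightarrow> real" where
  "quartic f = (\<Sum>e\<in>A. (transfer f e) ^ 4 / L e) / (transfer f f * L f)"

lemma transfer_square_weighted:
  assumes "e \<in> A" "f \<in> A"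
  shows "transfer f f / L f * ((transfer f e)\<^sup>2 / transfer f f) = (transfer e f)\<^sup>2 / L f"
  using transfer_commute [OF assms] transfer_eq_0 [OF assms(2,1)] by (cases "transfer f f = 0") auto

text \<open>Foster's theorem gives v - 1 copies of \<open>res_sum\<close>, and the corrections
  remove one by \<open>sum_transfer_square\<close>.\<close>

lemma sum_contracted_res_sum:
  "(\<Sum>f\<in>A. transfer f f / L f * contracted_res_sum f) = (real (card V) - 2) * res_sum"
proof -
  have "(\<Sum>f\<in>A. transfer f f / L f * contracted_res_sum f)
      = (\<Sum>f\<in>A. \<Sum>e\<in>A. transfer f f / L f * transfer e e - (transfer e f)\<^sup>2 / L f)"
    unfolding contracted_res_sum_def sum_distrib_left
    by (intro sum.cong refl) (simp only: right_diff_distrib transfer_square_weighted)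
  also have "\<dots> = (\<Sum>f\<in>A. transfer f f / L f) * res_sum - (\<Sum>e\<in>A. \<Sum>f\<in>A. (transfer e f)\<^sup>2 / L f)"
    unfolding sum_subtractf res_sum_def sum_product by (subst (2) sum.swap) simp
  also have "\<dots> = (real (card V) - 2) * res_sum"
    by (simp add: foster sum_transfer_square res_sum_def algebra_simps)
  finally show ?thesis .
qed

text \<open>After expanding the square, Foster's theorem gives v - 1 copies, the mixed terms remove
  two by \<open>sum_transfer_square\<close>, and the squared corrections are the quartic
  terms.\<close>

lemma sum_contracted_res_square_sum:
  "(\<Sum>f\<in>A. transfer f f / L f * contracted_res_square_sum f)
    = (real (card V) - 3) * res_square_sum + (\<Sum>f\<in>A. quartic f)"
proof -
  have "transfer f f / L f * contracted_res_square_sum f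
      = (\<Sum>e\<in>A. transfer f f / L f * ((transfer e e)\<^sup>2 / L e)
            - 2 * (transfer e e / L e) * ((transfer e f)\<^sup>2 / L f)) + quartic f"
    if f: "f \<in> A" for f
  proof -
    have "transfer f f / L f * ((transfer e e - (transfer f e)\<^sup>2 / transfer f f)\<^sup>2 / L e)
        = transfer f f / L f * ((transfer e e)\<^sup>2 / L e)
            - 2 * (transfer e e / L e) * ((transfer e f)\<^sup>2 / L f)
            + (transfer f e) ^ 4 / L e / (transfer f f * L f)" if e: "e \<in> A" for e
    proof (cases "transfer f f = 0")
      case True
      then show ?thesis
        using transfer_eq_0 [OF f e] transfer_commute [OF e f] by simp
    next
      case False
      then show ?thesis
        using transfer_commute [OF e f] length_pos [OF e] length_pos [OF f]
        by (simp add: field_simps power2_eq_square power4_eq_xxxx)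
    qed
    then show ?thesis
      unfolding contracted_res_square_sum_def quartic_def sum_distrib_left sum_divide_distrib
        sum.distrib [symmetric] by (intro sum.cong) auto
  qed
  then have "(\<Sum>f\<in>A. transfer f f / L f * contracted_res_square_sum f)
      = (\<Sum>f\<in>A. \<Sum>e\<in>A. transfer f f / L f * ((transfer e e)\<^sup>2 / L e))
        - (\<Sum>e\<in>A. \<Sum>f\<in>A. 2 * (transfer e e / L e) * ((transfer e f)\<^sup>2 / L f)) + (\<Sum>f\<in>A. quartic f)"
    by (subst (2) sum.swap) (simp add: sum.distrib sum_subtractf)
  also have "\<dots> = (\<Sum>f\<in>A. transfer f f / L f) * res_square_sum
        - (\<Sum>e\<in>A. 2 * (transfer e e / L e) * transfer e e) + (\<Sum>f\<in>A. quartic f)"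
    unfolding res_square_sum_def sum_product
    by (simp only: sum_distrib_left [symmetric] sum_transfer_square cong: sum.cong)
  also have "(\<Sum>e\<in>A. 2 * (transfer e e / L e) * transfer e e) = 2 * res_square_sum"
    by (simp add: res_square_sum_def sum_distrib_left power2_eq_square ac_simps)
  finally show ?thesis
    by (simp add: foster algebra_simps)
qed

text \<open>
  The cube comes from \<open>\<langle>\<psi>, \<psi>\<^sup>3\<rangle>\<close>, whose edge terms \<open>(a - b)\<^sup>2 (a\<^sup>2 + a b + b\<^sup>2)\<close> are compared with
  \<open>(a - b)\<^sup>2 (a + b)\<^sup>2\<close>; what is left over is the quartic sum.
\<close>

lemma energy_edge_potential_square:
  assumes "f \<in> A"
  shows "dir (\<lambda>x. (edge_potential f x)\<^sup>2) (\<lambda>x. (edge_potential f x)\<^sup>2)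
    = (diag (t f) - diag (h f))\<^sup>2 * transfer f f + (transfer f f) ^ 3 / 3
      - (\<Sum>e\<in>A. (transfer f e) ^ 4 / L e) / 3"
proof -
  let ?P = "edge_potential f"
  have "dir (\<lambda>x. (?P x)\<^sup>2) (\<lambda>x. (?P x)\<^sup>2)
      = 4 / 3 * dir ?P (\<lambda>x. (?P x) ^ 3) - 1 / 3 * (\<Sum>e\<in>A. (transfer f e) ^ 4 / L e)"
    unfolding energy_def sum_distrib_left sum_subtractf [symmetric]
  proof (intro sum.cong refl)
    fix e assume "e \<in> A"
    define a b where "a = ?P (t e)" and "b = ?P (h e)"
    have "(a\<^sup>2 - b\<^sup>2) * (a\<^sup>2 - b\<^sup>2) = 4 / 3 * ((a - b) * (a ^ 3 - b ^ 3)) - 1 / 3 * (a - b) ^ 4"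
      by algebra
    then show "((?P (t e))\<^sup>2 - (?P (h e))\<^sup>2) * ((?P (t e))\<^sup>2 - (?P (h e))\<^sup>2) / L e
      = 4 / 3 * ((?P (t e) - ?P (h e)) * (?P (t e) ^ 3 - ?P (h e) ^ 3) / L e)
        - 1 / 3 * (transfer f e ^ 4 / L e)"
      unfolding transfer_def a_def [symmetric] b_def [symmetric]
      by (simp only: diff_divide_distrib times_divide_eq_right)
  qed
  moreover have "4 / 3 * dir ?P (\<lambda>x. (?P x) ^ 3)
      = (diag (t f) - diag (h f))\<^sup>2 * transfer f f + (transfer f f) ^ 3 / 3"
  proof -
    have "diag (t f) - diag (h f) = ?P (t f) + ?P (h f)"
      using K_commute [OF tail_mem [OF assms] head_mem [OF assms]]
      by (simp add: diag_def edge_potential_def)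
    moreover have "4 / 3 * (a ^ 3 - b ^ 3) = (a + b)\<^sup>2 * (a - b) + (a - b) ^ 3 / 3" for a b :: real
      by (simp add: field_simps power2_eq_square power3_eq_cube)
    ultimately show ?thesis
      by (simp add: energy_edge_potential [OF assms] transfer_def)
  qed
  ultimately show ?thesis
    by simp
qed

lemma contracted_diag_energy_weighted:
  assumes "f \<in> A"
  shows "transfer f f / L f * contracted_diag_energy f
    = transfer f f / L f * diag_energy - 2 * (dir diag (\<lambda>x. (edge_potential f x)\<^sup>2) / L f)
      + (diag (t f) - diag (h f))\<^sup>2 / L f + (transfer f f)\<^sup>2 / L f / 3 - quartic f / 3"
proof (cases "t f = h f")
  case True
  then have "transfer f f = 0" "\<And>x. edge_potential f x = 0"
    by (auto simp: edge_potential_loop loop_transfer)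
  then show ?thesis
    using True by (simp add: energy_def quartic_def)
next
  case False
  let ?r = "transfer f f" and ?P2 = "\<lambda>x. (edge_potential f x)\<^sup>2"
  have r: "?r \<noteq> 0"
    using False transfer_self_eq_0_iff assms by simp
  have "contracted_diag_energy f
      = diag_energy - 2 * (1 / ?r) * dir diag ?P2 + (1 / ?r)\<^sup>2 * dir ?P2 ?P2"
    using energy_diff_scaled [of A t h L diag "1 / ?r" ?P2]
    by (simp add: contracted_diag_energy_def diag_energy_def)
  moreover have "r / l * (E - 2 * (1 / r) * X + (1 / r)\<^sup>2 * (D * r + r ^ 3 / 3 - q / 3))
      = r / l * E - 2 * (X / l) + D / l + r\<^sup>2 / l / 3 - q / (r * l) / 3"
    if "r \<noteq> 0" "0 < l" for r l E X D q :: real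
    using that by (simp add: field_simps power2_eq_square power3_eq_cube)
  ultimately show ?thesis
    using r length_pos [OF assms]
    by (simp only: energy_edge_potential_square [OF assms] quartic_def)
qed

text \<open>Foster's theorem gives v - 1 copies of \<open>diag_energy\<close>. By
  \<open>sum_edge_potential_square\<close> the mixed terms sum to minus two copies, and the squared
  differences of \<open>diag\<close> restore one. The cubes of the resistances give a third of
  \<open>res_square_sum\<close>.\<close>

lemma sum_contracted_diag_energy:
  "(\<Sum>f\<in>A. transfer f f / L f * contracted_diag_energy f)
    = (real (card V) - 2) * diag_energy + (res_square_sum - (\<Sum>f\<in>A. quartic f)) / 3"
proof -
  let ?P2 = "\<lambda>f x. (edge_potential f x)\<^sup>2"
  have "(\<Sum>f\<in>A. dir diag (?P2 f) / L f)
      = (\<Sum>e\<in>A. \<Sum>f\<in>A. (diag (t e) - diag (h e)) * (?P2 f (t e) / L f - ?P2 f (h e) / L f) / L e)"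
    unfolding energy_def sum_divide_distrib
    by (subst sum.swap) (intro sum.cong refl, simp add: diff_divide_distrib [symmetric] mult.commute)
  also have "\<dots> = (\<Sum>e\<in>A. (diag (t e) - diag (h e))
      * ((\<Sum>f\<in>A. ?P2 f (t e) / L f) - (\<Sum>f\<in>A. ?P2 f (h e) / L f)) / L e)"
    by (simp only: sum_distrib_left sum_divide_distrib sum_subtractf [symmetric])
  also have "\<dots> = diag_energy"
    unfolding diag_energy_def energy_def
    by (intro sum.cong refl) (simp add: sum_edge_potential_square tail_mem head_mem)
  finally have *: "(\<Sum>f\<in>A. dir diag (?P2 f) / L f) = diag_energy" .
  have "(\<Sum>f\<in>A. transfer f f / L f * contracted_diag_energy f)
      = (\<Sum>f\<in>A. transfer f f / L f) * diag_energy - 2 * (\<Sum>f\<in>A. dir diag (?P2 f) / L f)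
        + (\<Sum>f\<in>A. (diag (t f) - diag (h f))\<^sup>2 / L f) + (\<Sum>f\<in>A. (transfer f f)\<^sup>2 / L f) / 3
        - (\<Sum>f\<in>A. quartic f) / 3"
    by (simp only: contracted_diag_energy_weighted sum.distrib sum_subtractf sum_distrib_left
        sum_distrib_right sum_divide_distrib cong: sum.cong)
  also have "(\<Sum>f\<in>A. (diag (t f) - diag (h f))\<^sup>2 / L f) = diag_energy"
    by (simp add: diag_energy_def energy_def power2_eq_square)
  finally show ?thesis
    unfolding * foster res_square_sum_def by (simp add: algebra_simps diff_divide_distrib)
qed

text \<open>The weights 1 and 3 cancel the quartic sums; the factor 1/4 makes the value equal to the
  resistance when there are two vertices.\<close>

definition cut_mass :: real where
  "cut_mass = (res_square_sum + 3 * diag_energy) / 4"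

text \<open>The third of \<open>res_square_sum\<close> left over in the energy identity, taken three
  times, raises its coefficient from v - 3 to v - 2.\<close>

lemma sum_contracted_cut_mass:
  "(\<Sum>f\<in>A. transfer f f / L f * ((contracted_res_square_sum f + 3 * contracted_diag_energy f) / 4))
    = (real (card V) - 2) * cut_mass"
proof -
  have "(\<Sum>f\<in>A. transfer f f / L f * ((contracted_res_square_sum f + 3 * contracted_diag_energy f) / 4))
      = ((\<Sum>f\<in>A. transfer f f / L f * contracted_res_square_sum f)
        + 3 * (\<Sum>f\<in>A. transfer f f / L f * contracted_diag_energy f)) / 4"
    by (simp add: sum.distrib [symmetric] sum_distrib_left sum_divide_distrib algebra_simps
        add_divide_distrib)
  then show ?thesis
    unfolding sum_contracted_res_square_sum sum_contracted_diag_energy cut_mass_def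
    by (simp add: field_simps)
qed

end

section \<open>Edge cuts under contraction and the comparison of \<open>cut_mass\<close> with
  \<open>res_sum\<close>\<close>

definition edge_connected :: "'e set \<Rightarrow> 'v set \<Rightarrow> ('e \<Rightarrow> 'v) \<Rightarrow> ('e \<Rightarrow> 'v) \<Rightarrow> nat \<Rightarrow> bool" where
  "edge_connected A V t h n \<longleftrightarrow>
    (\<forall>X. X \<subseteq> V \<and> X \<noteq> {} \<and> X \<noteq> V \<longrightarrow> n \<le> card {e\<in>A. (t e \<in> X) \<noteq> (h e \<in> X)})"

text \<open>Cuts of the contracted graph pull back along \<sigma> to cuts of the original graph with
  the same edges.\<close>

lemma edge_connected_contraction:
  assumes conn: "edge_connected A V t h n"
    and ends: "\<And>e. e \<in> A \<Longrightarrow> t e \<in> V" "\<And>e. e \<in> A \<Longrightarrow> h e \<in> V"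
    and "d \<in> V" and \<sigma>: "\<And>x. x \<in> V - {d} \<Longrightarrow> \<sigma> x = x"
  shows "edge_connected A (V - {d}) (\<sigma> \<circ> t) (\<sigma> \<circ> h) n"
  unfolding edge_connected_def
proof (intro allI impI, elim conjE)
  fix X assume X: "X \<subseteq> V - {d}" "X \<noteq> {}" "X \<noteq> V - {d}"
  define Y where "Y = {x\<in>V. \<sigma> x \<in> X}"
  obtain x z where "x \<in> X" "z \<in> V - {d}" "z \<notin> X"
    using X by blast
  moreover from this have "\<sigma> x = x" "\<sigma> z = z"
    using X(1) \<sigma> by blast+
  ultimately have "Y \<subseteq> V" "x \<in> Y" "z \<in> V - Y"
    using X(1) by (auto simp: Y_def)
  then have "Y \<subseteq> V" "Y \<noteq> {}" "Y \<noteq> V"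
    by auto
  then have "n \<le> card {e\<in>A. (t e \<in> Y) \<noteq> (h e \<in> Y)}"
    using conn by (auto simp: edge_connected_def)
  also have "{e\<in>A. (t e \<in> Y) \<noteq> (h e \<in> Y)} = {e\<in>A. ((\<sigma> \<circ> t) e \<in> X) \<noteq> ((\<sigma> \<circ> h) e \<in> X)}"
    using ends by (auto simp: Y_def)
  finally show "n \<le> card {e\<in>A. ((\<sigma> \<circ> t) e \<in> X) \<noteq> ((\<sigma> \<circ> h) e \<in> X)}" .
qed

context grounded_network
begin

text \<open>As \<open>contracted f\<close> is invariant under \<sigma>, everything can be evaluated
  at the original ends. This makes the averaged identities usable in an induction on the number of
  vertices.\<close>

lemma contracted_parameters:
  assumes "d \<in> V" and \<sigma>_mem: "\<And>x. x \<in> V \<Longrightarrow> \<sigma> x \<in> V - {d}"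
    and \<sigma>_K: "\<And>x y. x \<in> V \<Longrightarrow> y \<in> V \<Longrightarrow> contracted f (\<sigma> x) (\<sigma> y) = contracted f x y"
    and net: "grounded_network A (V - {d}) (\<sigma> \<circ> t) (\<sigma> \<circ> h) L ground (contracted f)"
    and f: "f \<in> A"
  shows "grounded_network.res_sum A (\<sigma> \<circ> t) (\<sigma> \<circ> h) (contracted f) = contracted_res_sum f"
    and "grounded_network.cut_mass A (\<sigma> \<circ> t) (\<sigma> \<circ> h) L (contracted f)
      = (contracted_res_square_sum f + 3 * contracted_diag_energy f) / 4"
proof -
  interpret c: grounded_network A "V - {d}" "\<sigma> \<circ> t" "\<sigma> \<circ> h" L ground "contracted f"
    by (rule net)
  have transfer: "c.transfer e e = transfer e e - (transfer f e)\<^sup>2 / transfer f f" if e: "e \<in> A" for e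
  proof -
    have "c.transfer e e = contracted f (t e) (t e) - contracted f (h e) (t e)
        - (contracted f (t e) (h e) - contracted f (h e) (h e))"
      using e by (simp add: c.transfer_def c.edge_potential_def \<sigma>_K tail_mem head_mem)
    also have "\<dots> = transfer e e - (transfer f e)\<^sup>2 / transfer f f"
      by (simp add: contracted_def transfer_def [of e e] transfer_def [of f e] edge_potential_def [of e]
          power2_eq_square left_diff_distrib right_diff_distrib diff_divide_distrib
          add_divide_distrib)
    finally show ?thesis .
  qed
  have diag: "c.diag (\<sigma> x) = diag x - (edge_potential f x)\<^sup>2 / transfer f f" if "x \<in> V" for x
    using that \<sigma>_K by (simp add: c.diag_def diag_def contracted_def power2_eq_square)
  show "c.res_sum = contracted_res_sum f"
    by (simp add: c.res_sum_def contracted_res_sum_def transfer)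
  have "c.res_square_sum = contracted_res_square_sum f"
    by (simp add: c.res_square_sum_def contracted_res_square_sum_def transfer)
  moreover have "c.diag_energy = contracted_diag_energy f"
    unfolding c.diag_energy_def contracted_diag_energy_def
    by (rule energy_cong) (simp_all add: diag tail_mem head_mem)
  ultimately show "c.cut_mass = (contracted_res_square_sum f + 3 * contracted_diag_energy f) / 4"
    by (simp add: c.cut_mass_def)
qed

text \<open>All edges are loops or parallel, and each of the parallel ones has the same resistance
  \<open>K q q\<close> between its ends. Foster's theorem says that their conductances sum to its
  inverse, so \<open>res_square_sum\<close> and \<open>diag_energy\<close> both equal
  \<open>K q q\<close>.\<close>

lemma cut_mass_two_vertices:
  assumes "card V = 2"
  shows "res_sum = real (card {e\<in>A. (t e = ground) \<noteq> (h e = ground)}) * cut_mass" "0 \<le> cut_mass"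
proof -
  obtain q where V: "V = {ground, q}" and q: "q \<noteq> ground"
    using assms ground_mem by (auto simp: card_2_iff)
  let ?c = "\<lambda>e. (t e = ground) \<noteq> (h e = ground)"
  have ends: "t e \<in> {ground, q}" "h e \<in> {ground, q}" if "e \<in> A" for e
    using that tail_mem head_mem V by auto
  have K: "K ground ground = 0" "K ground q = 0" "K q ground = 0"
    using K_ground K_ground_left V by auto
  have transfer: "transfer e e = (if ?c e then K q q else 0)" if "e \<in> A" for e
    using ends [OF that] K q by (auto simp: transfer_def edge_potential_def)
  have diag: "(diag (t e) - diag (h e)) * (diag (t e) - diag (h e)) = (if ?c e then K q q * K q q else 0)" if "e \<in> A" for e
    using ends [OF that] K q by (auto simp: diag_def)
  have "(\<Sum>e\<in>A. transfer e e / L e) = 1"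
    using foster assms by simp
  then have "K q q * (\<Sum>e\<in>A. if ?c e then K q q / L e else 0) = K q q"
    by (simp add: transfer if_distrib [of "\<lambda>x. x / _"] cong: sum.cong if_cong)
  moreover have "res_square_sum = K q q * (\<Sum>e\<in>A. if ?c e then K q q / L e else 0)"
    unfolding res_square_sum_def sum_distrib_left
    by (intro sum.cong) (auto simp: transfer power2_eq_square)
  moreover have "diag_energy = K q q * (\<Sum>e\<in>A. if ?c e then K q q / L e else 0)"
    unfolding diag_energy_def energy_def sum_distrib_left by (intro sum.cong refl) (simp add: diag)
  ultimately have mass: "cut_mass = K q q"
    by (simp add: cut_mass_def)
  show "res_sum = real (card {e\<in>A. ?c e}) * cut_mass"
    unfolding mass res_sum_def using finite_edges
    by (simp add: transfer sum.inter_filter [symmetric] cong: sum.cong)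
  have "K q q = dir (K q) (K q)"
    using energy_K [of q "K q"] V K by simp
  also have "\<dots> \<ge> 0"
    unfolding energy_def by (intro sum_nonneg) (simp add: length_pos less_imp_le)
  finally show "0 \<le> cut_mass"
    using mass by simp
qed

end

text \<open>
  In terms of spanning forests, \<open>res_sum\<close> and \<open>cut_mass\<close> are the sums of \<open>w F * \<bar>cut F\<bar>\<close> and of
  \<open>w F\<close> over the spanning forests \<open>F\<close> with two components, divided by the weighted number of
  spanning trees.  Contracting edges with probabilities \<open>transfer f f / L f\<close> reduces this to
  networks with two vertices.
\<close>

lemma cut_mass_le:
  assumes "grounded_network A V t h L ground K" and "edge_connected A V t h n"
  shows "real n * grounded_network.cut_mass A t h L K \<le> grounded_network.res_sum A t h K"
  using assms
proof (induction "card V" arbitrary: V t h K)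
  case 0
  then interpret grounded_network A V t h L ground K
    by simp
  show ?case
    using 0 finite_vertices ground_mem by auto
next
  case (Suc m)
  interpret grounded_network A V t h L ground K
    by (rule Suc.prems)
  consider "m = 0" | "m = 1" | "m \<ge> 2"
    by linarith
  then show ?case
  proof cases
    case 1
    then have "card V = 1"
      using Suc.hyps by simp
    then have "V = {ground}"
      using ground_mem by (auto simp: card_1_singleton_iff)
    then have "t e = h e" if "e \<in> A" for e
      using that tail_mem head_mem by auto
    then show ?thesis
      by (simp add: cut_mass_def res_sum_def res_square_sum_def diag_energy_def energy_def loop_transfer)
  next
    case 2
    then have V: "card V = 2"
      using Suc.hyps by simp
    then have "{ground} \<noteq> V"
      by auto
    then have "n \<le> card {e\<in>A. (t e = ground) \<noteq> (h e = ground)}"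
      using Suc.prems(2) ground_mem by (fastforce simp: edge_connected_def dest: spec [of _ "{ground}"])
    then show ?thesis
      using cut_mass_two_vertices [OF V] by (simp add: mult_right_mono)
  next
    case 3
    let ?Q = "\<lambda>f. (contracted_res_square_sum f + 3 * contracted_diag_energy f) / 4"
    have step: "transfer f f / L f * (real n * ?Q f) \<le> transfer f f / L f * contracted_res_sum f"
      if f: "f \<in> A" for f
    proof (cases "t f = h f")
      \<comment> \<open>Loops have weight 0.\<close>
      case True
      then show ?thesis
        by (simp add: loop_transfer)
    next
      case False
      obtain d \<sigma> where c: "d \<in> V" "\<And>x. x \<in> V \<Longrightarrow> \<sigma> x \<in> V - {d}" "\<And>x. x \<in> V - {d} \<Longrightarrow> \<sigma> x = x"
          "\<And>x y. x \<in> V \<Longrightarrow> y \<in> V \<Longrightarrow> contracted f (\<sigma> x) (\<sigma> y) = contracted f x y"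
          "grounded_network A (V - {d}) (\<sigma> \<circ> t) (\<sigma> \<circ> h) L ground (contracted f)"
        using contraction [OF f False] by metis
      have "m = card (V - {d})"
        using Suc.hyps(2) c(1) finite_vertices by simp
      moreover have "edge_connected A (V - {d}) (\<sigma> \<circ> t) (\<sigma> \<circ> h) n"
        using edge_connected_contraction [OF Suc.prems(2) tail_mem head_mem c(1,3)] .
      ultimately have "real n * ?Q f \<le> contracted_res_sum f"
        using Suc.hyps(1) c(5) contracted_parameters [OF c(1,2,4,5) f] by metis
      then show ?thesis
        using f transfer_self_nonneg length_pos by (intro mult_left_mono) (auto simp: less_imp_le)
    qed
    \<comment> \<open>Both averages carry the factor v - 2, which is positive because v is at least
      3 here.\<close>
    have "(real (card V) - 2) * (real n * cut_mass)
        = (\<Sum>f\<in>A. transfer f f / L f * (real n * ?Q f))"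
      using sum_contracted_cut_mass
      by (simp only: mult.left_commute [of _ "real n"] sum_distrib_left [symmetric])
    also have "\<dots> \<le> (\<Sum>f\<in>A. transfer f f / L f * contracted_res_sum f)"
      by (rule sum_mono) (rule step)
    also have "\<dots> = (real (card V) - 2) * res_sum"
      by (rule sum_contracted_res_sum)
    finally show ?thesis
      using 3 Suc.hyps(2) by simp
  qed
qed

section \<open>Existence of the potentials\<close>

text \<open>By the Sherman-Morrison formula, the new potentials are a rank-one update of the old ones.\<close>

lemma grounded_network_insert_edge:
  assumes "grounded_network A V t h L ground K"
    and e: "e \<notin> A" "t e \<in> V" "h e \<in> V" "0 < L e"
  shows "\<exists>K'. grounded_network (insert e A) V t h L ground K'"
proof -
  interpret grounded_network A V t h L ground K
    by fact
  define P where "P x = K (t e) x - K (h e) x" for x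
  define r where "r = P (t e) - P (h e)"
  define K' where "K' x y = K x y - P x / (L e + r) * P y" for x y
  have dir_P: "dir P \<phi> = \<phi> (t e) - \<phi> (h e)" for \<phi>
    unfolding P_def energy_diff_left using e energy_K by simp
  \<comment> \<open>The energy of P is r, so the denominator \<open>L e + r\<close> of the update is
    positive.\<close>
  have "0 \<le> dir P P"
    unfolding energy_def by (intro sum_nonneg) (simp add: length_pos less_imp_le)
  then have pos: "0 < L e + r"
    using e dir_P [of P] by (simp add: r_def)
  have "grounded_network (insert e A) V t h L ground K'"
  proof
    show "energy (insert e A) t h L (K' x) \<phi> = \<phi> x - \<phi> ground" if x: "x \<in> V" for x \<phi>
    proof -
      have "K x (t e) - K x (h e) = P x"
        using x e K_commute by (simp add: P_def)
      moreover have "K' x (t e) - K' x (h e) = K x (t e) - K x (h e) - P x / (L e + r) * r"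
        by (simp add: K'_def r_def right_diff_distrib diff_divide_distrib)
      ultimately have "K' x (t e) - K' x (h e) = P x / (L e + r) * L e"
        using pos by (simp add: field_simps)
      moreover have "dir (K' x) \<phi> = dir (K x) \<phi> - P x / (L e + r) * dir P \<phi>"
        using energy_linear_left [of A t h L 1 "K x" "- (P x / (L e + r))" P \<phi>]
        by (simp add: K'_def [abs_def])
      moreover have "energy (insert e A) t h L (K' x) \<phi>
          = (K' x (t e) - K' x (h e)) * (\<phi> (t e) - \<phi> (h e)) / L e + dir (K' x) \<phi>"
        using e finite_edges by (simp add: energy_def)
      ultimately show ?thesis
        using e x by (simp add: dir_P energy_K)
    qed
    show "K' x ground = 0" if "x \<in> V" for x
      using that e K_ground by (simp add: K'_def P_def)
  qed (use finite_edges finite_vertices tail_mem head_mem length_pos ground_mem e in auto)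
  then show ?thesis
    by blast
qed

text \<open>A current entering at p first crosses e, which adds \<open>L e\<close> to the potential
  at p. A current entering elsewhere does not use e, so p has the potential of q.\<close>

lemma grounded_network_insert_leaf:
  assumes "grounded_network A V t h L ground K"
    and e: "e \<notin> A" "0 < L e" and ends: "{t e, h e} = {p, q}" and p: "p \<notin> V" and q: "q \<in> V"
  shows "\<exists>K'. grounded_network (insert e A) (insert p V) t h L ground K'"
proof -
  interpret grounded_network A V t h L ground K
    by fact
  define \<pi> where "\<pi> x = (if x = p then q else x)" for x
  define K' where "K' x y = K (\<pi> x) (\<pi> y) + (if x = p \<and> y = p then L e else 0)" for x y
  have ne: "p \<noteq> q" "ground \<noteq> p"
    using p q ground_mem by auto
  have "grounded_network (insert e A) (insert p V) t h L ground K'"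
  proof
    show "energy (insert e A) t h L (K' x) \<phi> = \<phi> x - \<phi> ground" if x: "x \<in> insert p V" for x \<phi>
    proof -
      have \<pi>x: "\<pi> x \<in> V"
        using x q by (auto simp: \<pi>_def)
      have "energy (insert e A) t h L (K' x) \<phi>
          = (K' x (t e) - K' x (h e)) * (\<phi> (t e) - \<phi> (h e)) / L e + dir (K' x) \<phi>"
        using e finite_edges by (simp add: energy_def)
      also have "dir (K' x) \<phi> = dir (K (\<pi> x)) \<phi>"
      proof (rule energy_cong)
        fix f assume "f \<in> A"
        then have "t f \<noteq> p" "h f \<noteq> p"
          using tail_mem head_mem p by auto
        then show "K' x (t f) - K' x (h f) = K (\<pi> x) (t f) - K (\<pi> x) (h f)"
          by (simp add: K'_def \<pi>_def)
      qed simp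
      also have "\<dots> = \<phi> (\<pi> x) - \<phi> ground"
        using energy_K [OF \<pi>x] .
      also have "(K' x (t e) - K' x (h e)) * (\<phi> (t e) - \<phi> (h e)) / L e = \<phi> x - \<phi> (\<pi> x)"
        using ends ne e by (auto simp: doubleton_eq_iff K'_def \<pi>_def)
      finally show ?thesis
        by simp
    qed
    show "K' x ground = 0" if "x \<in> insert p V" for x
      using that ne q K_ground by (auto simp: K'_def \<pi>_def)
    show "t f \<in> insert p V" "h f \<in> insert p V" if "f \<in> insert e A" for f
      using that ends q tail_mem head_mem by (auto simp: doubleton_eq_iff)
  qed (use finite_edges finite_vertices length_pos ground_mem e in auto)
  then show ?thesis
    by blast
qed

text \<open>Starting from the ground alone, take a sub-network with potentials that has the most
  edges. If a vertex is missing, connectivity provides an edge leaving the sub-network, and a leaf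
  can be attached; if only edges are missing, one can be inserted.\<close>

lemma grounded_network_exists:
  assumes "finite A" "finite V" "ground \<in> V"
    and ends: "\<And>e. e \<in> A \<Longrightarrow> t e \<in> V" "\<And>e. e \<in> A \<Longrightarrow> h e \<in> V"
    and pos: "\<And>e. e \<in> A \<Longrightarrow> 0 < L e"
    and conn: "edge_connected A V t h 1"
  shows "\<exists>K. grounded_network A V t h L ground K"
proof -
  define sub where "sub B W \<longleftrightarrow> B \<subseteq> A \<and> W \<subseteq> V \<and> (\<exists>K. grounded_network B W t h L ground K)" for B W
  have "grounded_network {} {ground} t h L ground (\<lambda>_ _. 0)"
    by standard (auto simp: energy_def)
  then have "sub {} {ground}"
    using assms(3) by (auto simp: sub_def)
  then have "\<exists>W. sub {} W" ..
  moreover have "\<forall>B. (\<exists>W. sub B W) \<longrightarrow> card B < Suc (card A)"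
    using \<open>finite A\<close> by (auto simp: sub_def less_Suc_eq_le card_mono)
  ultimately have "\<exists>B. (\<exists>W. sub B W) \<and> (\<forall>B'. (\<exists>W'. sub B' W') \<longrightarrow> card B' \<le> card B)"
    by (rule ex_has_greatest_nat)
  then obtain B where "\<exists>W. sub B W" and max: "\<And>B' W'. sub B' W' \<Longrightarrow> card B' \<le> card B"
    by blast
  then obtain W K where B: "B \<subseteq> A" and W: "W \<subseteq> V" and net: "grounded_network B W t h L ground K"
    by (auto simp: sub_def)
  have stuck: "\<not> sub (insert e B) W'" if "e \<in> A - B" for e W'
    using that max [of "insert e B" W'] finite_subset [OF B \<open>finite A\<close>] by auto
  have "W \<noteq> {}"
    using net grounded_network.ground_mem by fastforce
  have "W = V"
  proof (rule ccontr)
    assume "W \<noteq> V"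
    then have "1 \<le> card {e\<in>A. (t e \<in> W) \<noteq> (h e \<in> W)}"
      using conn W \<open>W \<noteq> {}\<close> by (auto simp: edge_connected_def)
    then have "{e\<in>A. (t e \<in> W) \<noteq> (h e \<in> W)} \<noteq> {}"
      by (metis card.empty not_one_le_zero)
    then obtain e where e: "e \<in> A" "(t e \<in> W) \<noteq> (h e \<in> W)"
      by auto
    then have "e \<notin> B"
      using grounded_network.tail_mem [OF net] grounded_network.head_mem [OF net] by auto
    obtain p q where pq: "{t e, h e} = {p, q}" "p \<notin> W" "q \<in> W"
    proof (cases "t e \<in> W")
      case True
      then show ?thesis
        using that [of "h e" "t e"] e(2) by (simp add: insert_commute)
    next
      case False
      then show ?thesis
        using that [of "t e" "h e"] e(2) by simp
    qed
    have "p \<in> V"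
      using pq ends e(1) by (auto simp: doubleton_eq_iff)
    then have "sub (insert e B) (insert p W)"
      using grounded_network_insert_leaf [OF net \<open>e \<notin> B\<close> pos pq] e B W by (auto simp: sub_def)
    then show False
      using stuck e \<open>e \<notin> B\<close> by blast
  qed
  moreover have "B = A"
  proof (rule ccontr)
    assume "B \<noteq> A"
    then obtain e where "e \<in> A - B"
      using B by auto
    then have "sub (insert e B) W"
      using grounded_network_insert_edge [OF net, of e] ends pos B W \<open>W = V\<close> by (auto simp: sub_def)
    then show False
      using stuck \<open>e \<in> A - B\<close> by blast
  qed
  ultimately show ?thesis
    using net by blast
qed

section \<open>Resistances in a metrized graph\<close>

text \<open>Summation by parts: each arc is met once at its tail and once at its head.\<close>

lemma sum_potential_energy:
  assumes "fin_digraph H"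
  shows "energy (arcs H) (tail H) (head H) R f \<phi> =
    (\<Sum>p\<in>verts H. \<phi> p * ((\<Sum>a\<in>out_arcs H p. (f p - f (head H a)) / R a) +
        (\<Sum>a\<in>in_arcs H p. (f p - f (tail H a)) / R a)))"
proof -
  interpret fin_digraph H
    by fact
  let ?out = "\<lambda>a. \<phi> (tail H a) * ((f (tail H a) - f (head H a)) / R a)"
  let ?in = "\<lambda>a. \<phi> (head H a) * ((f (head H a) - f (tail H a)) / R a)"
  have "(\<Sum>p\<in>verts H. \<phi> p * ((\<Sum>a\<in>out_arcs H p. (f p - f (head H a)) / R a) +
        (\<Sum>a\<in>in_arcs H p. (f p - f (tail H a)) / R a)))
      = (\<Sum>p\<in>verts H. sum ?out {a\<in>arcs H. tail H a = p}) + (\<Sum>p\<in>verts H. sum ?in {a\<in>arcs H. head H a = p})"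
    unfolding distrib_left sum.distrib sum_distrib_left
    by (intro arg_cong2 [of _ _ _ _ "(+)"] sum.cong) (auto simp: out_arcs_def in_arcs_def)
  also have "\<dots> = sum ?out (arcs H) + sum ?in (arcs H)"
    by (subst (1 2) sum.group) auto
  also have "\<dots> = energy (arcs H) (tail H) (head H) R f \<phi>"
    unfolding energy_def sum.distrib [symmetric]
    by (intro sum.cong refl) (simp add: algebra_simps diff_divide_distrib add_divide_distrib)
  finally show ?thesis ..
qed

lemma unit_current_potential_iff_energy:
  assumes "fin_digraph H" and xy: "x \<in> verts H" "y \<in> verts H"
  shows "unit_current_potential H R x y f \<longleftrightarrow>
    (\<forall>\<phi>. energy (arcs H) (tail H) (head H) R f \<phi> = \<phi> x - \<phi> y)"
proof -
  interpret fin_digraph H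
    by fact
  let ?I = "\<lambda>p. (\<Sum>a\<in>out_arcs H p. (f p - f (head H a)) / R a) +
        (\<Sum>a\<in>in_arcs H p. (f p - f (tail H a)) / R a)"
  let ?\<delta> = "\<lambda>p. (if p = x then 1 else 0) - (if p = y then 1 else 0) :: real"
  have \<delta>: "(\<Sum>p\<in>verts H. \<phi> p * ?\<delta> p) = \<phi> x - \<phi> y" for \<phi> :: "_ \<Rightarrow> real"
    unfolding right_diff_distrib sum_subtractf using xy by (simp add: mult_delta_right)
  show ?thesis
    unfolding unit_current_potential_def sum_potential_energy [OF assms(1)]
  proof (intro iffI allI ballI)
    fix \<phi> assume "\<forall>p\<in>verts H. ?I p = ?\<delta> p"
    then show "(\<Sum>p\<in>verts H. \<phi> p * ?I p) = \<phi> x - \<phi> y"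
      by (simp only: \<delta> cong: sum.cong)
  next
    fix p assume *: "\<forall>\<phi>. (\<Sum>p\<in>verts H. \<phi> p * ?I p) = \<phi> x - \<phi> y" and "p \<in> verts H"
    \<comment> \<open>Test with the indicator function of p.\<close>
    then have "?I p = (\<Sum>q\<in>verts H. (if q = p then 1 else 0) * ?I q)"
      by (simp add: mult_delta_left)
    also have "\<dots> = (if x = p then 1 else 0) - (if y = p then 1 else 0)"
      by (rule * [rule_format])
    also have "\<dots> = ?\<delta> p"
      by auto
    finally show "?I p = ?\<delta> p" .
  qed
qed

text \<open>Two potentials for the same current are compared by testing each one with the other.\<close>

lemma effective_resistance_eq:
  assumes "fin_digraph H" "x \<in> verts H" "y \<in> verts H"
    and f: "\<And>\<phi>. energy (arcs H) (tail H) (head H) R f \<phi> = \<phi> x - \<phi> y"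
  shows "effective_resistance H R x y = f x - f y"
  unfolding effective_resistance_def unit_current_potential_iff_energy [OF assms(1-3)]
proof (rule the_equality)
  show "\<exists>g. (\<forall>\<phi>. energy (arcs H) (tail H) (head H) R g \<phi> = \<phi> x - \<phi> y) \<and> f x - f y = g x - g y"
    using f by blast
  fix r assume "\<exists>g. (\<forall>\<phi>. energy (arcs H) (tail H) (head H) R g \<phi> = \<phi> x - \<phi> y) \<and> r = g x - g y"
  then show "r = f x - f y"
    using f energy_commute by metis
qed

section \<open>Subdivided intervals\<close>

definition steps :: "real set \<Rightarrow> (real \<times> real) set" where
  "steps C = {(a, b). a \<in> C \<and> b \<in> C \<and> a < b \<and> C \<inter> {a<..<b} = {}}"

lemma finite_steps: "finite C \<Longrightarrow> finite (steps C)"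
  by (rule finite_subset [of _ "C \<times> C"]) (auto simp: steps_def)

text \<open>Telescoping: a new largest point adds just the step from the old maximum.\<close>

lemma sum_steps:
  fixes \<psi> :: "real \<Rightarrow> real"
  assumes "finite C" "C \<noteq> {}"
  shows "(\<Sum>(a, b)\<in>steps C. \<psi> b - \<psi> a) = \<psi> (Max C) - \<psi> (Min C)"
  using assms
proof (induction C rule: finite_linorder_max_induct)
  case (insert b C)
  show ?case
  proof (cases "C = {}")
    case True
    have "steps {b} = {}"
      by (auto simp: steps_def)
    then show ?thesis
      using True by simp
  next
    case False
    have less: "Max C < b"
      using insert False by simp
    have "steps (insert b C) = insert (Max C, b) (steps C)"
    proof (intro equalityI subsetI)
      fix z assume "z \<in> steps (insert b C)"
      then obtain a c where z: "z = (a, c)" "a \<in> insert b C" "c \<in> insert b C" "a < c"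
          "insert b C \<inter> {a<..<c} = {}"
        by (auto simp: steps_def)
      have a: "a \<in> C"
        using z insert.hyps(2) by force
      show "z \<in> insert (Max C, b) (steps C)"
      proof (cases "c = b")
        case True
        have "\<not> a < Max C"
          using z True less Max_in [OF insert.hyps(1) False] by force
        then have "a = Max C"
          using Max_ge [OF insert.hyps(1) a] by simp
        then show ?thesis
          using z True by simp
      next
        case False
        then show ?thesis
          using z a by (auto simp: steps_def)
      qed
    next
      fix z assume "z \<in> insert (Max C, b) (steps C)"
      then show "z \<in> steps (insert b C)"
      proof
        assume "z = (Max C, b)"
        moreover have "insert b C \<inter> {Max C<..<b} = {}"
          using Max_ge [OF insert.hyps(1)] by fastforce
        moreover have "Max C \<in> C"
          using Max_in [OF insert.hyps(1) False] .
        ultimately show ?thesis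
          using less unfolding steps_def by blast
      next
        assume "z \<in> steps C"
        then show ?thesis
          using insert.hyps(2) by (force simp: steps_def)
      qed
    qed
    moreover have "(Max C, b) \<notin> steps C"
      using insert.hyps(2) by (auto simp: steps_def)
    moreover have "Max (insert b C) = b" "Min (insert b C) = Min C"
      using insert.hyps False less Min_in [OF insert.hyps(1) False] by (simp_all add: less_imp_le)
    ultimately show ?thesis
      using insert False finite_steps by simp
  qed
qed simp

text \<open>Green's function of the interval \<open>[0, l]\<close> with Dirichlet boundary values.\<close>

definition green :: "real \<Rightarrow> real \<Rightarrow> real \<Rightarrow> real" where
  "green l s t = min s t * (l - max s t) / l"

lemma green_commute: "green l s t = green l t s"
  by (simp add: green_def min.commute max.commute)

lemma green_boundary: "0 \<le> s \<Longrightarrow> s \<le> l \<Longrightarrow> green l s 0 = 0" "0 \<le> s \<Longrightarrow> s \<le> l \<Longrightarrow> green l s l = 0"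
  by (simp_all add: green_def)

text \<open>\<open>green l s\<close> is affine with slope 1 - s / l before s and - s / l after it.
  Clamping the argument with \<open>min\<close> and \<open>max\<close> lets the two sides telescope
  over the whole subdivision.\<close>

lemma sum_steps_green:
  assumes C: "finite C" "Min C = 0" "Max C = l" and s: "s \<in> C" and l: "0 < l"
  shows "(\<Sum>(a, b)\<in>steps C. (green l s b - green l s a) * (\<Phi> b - \<Phi> a) / (b - a))
    = \<Phi> s - ((1 - s / l) * \<Phi> 0 + s / l * \<Phi> l)"
proof -
  have "C \<noteq> {}" "0 \<le> s" "s \<le> l"
    using C s Min_le [of C s] Max_ge [of C s] by auto
  have "(\<Sum>(a, b)\<in>steps C. (green l s b - green l s a) * (\<Phi> b - \<Phi> a) / (b - a))
      = (\<Sum>(a, b)\<in>steps C. (1 - s / l) * (\<Phi> (min b s) - \<Phi> (min a s))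
          - s / l * (\<Phi> (max b s) - \<Phi> (max a s)))"
  proof (intro sum.cong refl, clarify)
    fix a b assume "(a, b) \<in> steps C"
    then have "a < b" "b \<le> s \<or> s \<le> a"
      using s by (force simp: steps_def)+
    then show "(green l s b - green l s a) * (\<Phi> b - \<Phi> a) / (b - a)
        = (1 - s / l) * (\<Phi> (min b s) - \<Phi> (min a s)) - s / l * (\<Phi> (max b s) - \<Phi> (max a s))"
    proof (elim disjE)
      assume "b \<le> s"
      then have "green l s b - green l s a = (1 - s / l) * (b - a)"
        using \<open>a < b\<close> l by (simp add: green_def field_simps)
      then show ?thesis
        using \<open>b \<le> s\<close> \<open>a < b\<close> by simp
    next
      assume "s \<le> a"
      then have "green l s b - green l s a = - (s / l) * (b - a)"
        using \<open>a < b\<close> l by (simp add: green_def field_simps)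
      then show ?thesis
        using \<open>s \<le> a\<close> \<open>a < b\<close> by simp
    qed
  qed
  also have "\<dots> = (1 - s / l) * (\<Sum>(a, b)\<in>steps C. \<Phi> (min b s) - \<Phi> (min a s))
      - s / l * (\<Sum>(a, b)\<in>steps C. \<Phi> (max b s) - \<Phi> (max a s))"
    unfolding sum_distrib_left sum_subtractf [symmetric] by (simp add: case_prod_unfold)
  also have "\<dots> = (1 - s / l) * (\<Phi> s - \<Phi> 0) - s / l * (\<Phi> l - \<Phi> s)"
    using sum_steps [OF C(1) \<open>C \<noteq> {}\<close>, of "\<lambda>t. \<Phi> (min t s)"]
      sum_steps [OF C(1) \<open>C \<noteq> {}\<close>, of "\<lambda>t. \<Phi> (max t s)"] C \<open>0 \<le> s\<close> \<open>s \<le> l\<close>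
    by (simp add: min_def max_def)
  also have "\<dots> = \<Phi> s - ((1 - s / l) * \<Phi> 0 + s / l * \<Phi> l)"
    by (simp add: algebra_simps)
  finally show ?thesis .
qed

section \<open>Potentials between arbitrary points of the metrized graph\<close>

fun interpolate ::
    "('a, 'b) pre_digraph \<Rightarrow> ('b \<Rightarrow> real) \<Rightarrow> ('a \<Rightarrow> real) \<Rightarrow> ('a, 'b) mg_point \<Rightarrow> real" where
  "interpolate G len \<phi> (Vertex p) = \<phi> p"
| "interpolate G len \<phi> (Inner e t) = (1 - t / len e) * \<phi> (tail G e) + t / len e * \<phi> (head G e)"

fun edge_green :: "('b \<Rightarrow> real) \<Rightarrow> ('a, 'b) mg_point \<Rightarrow> ('a, 'b) mg_point \<Rightarrow> real" where
  "edge_green len (Inner e s) (Inner e' t) = (if e = e' then green (len e) s t else 0)"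
| "edge_green len _ _ = 0"

lemma edge_green_commute: "edge_green len x z = edge_green len z x"
  by (cases x; cases z) (auto simp: green_commute)

locale metrized_network =
  metrized_graph G len + grounded_network "arcs G" "verts G" "tail G" "head G" len ground K
  for G :: "('a, 'b) pre_digraph" and len ground K
begin

lemma edge_point_mem: "e \<in> arcs G \<Longrightarrow> 0 \<le> t \<Longrightarrow> t \<le> len e \<Longrightarrow> edge_point G len e t \<in> points G len"
  by (auto simp: edge_point_def points_def)

lemma interpolate_edge_point:
  "e \<in> arcs G \<Longrightarrow> interpolate G len \<phi> (edge_point G len e t)
    = (1 - t / len e) * \<phi> (tail G e) + t / len e * \<phi> (head G e)"
  using len_pos [of e] by (simp add: edge_point_def)

lemma edge_green_vertex: "edge_green len x (Vertex p) = 0"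
  by (cases x) auto

lemma edge_green_edge_point_same:
  assumes "0 \<le> s" "s \<le> len e"
  shows "edge_green len (Inner e s) (edge_point G len e t) = green (len e) s t"
  using assms green_boundary [of s "len e"] by (simp add: edge_point_def edge_green_vertex)

lemma edge_green_edge_point_other:
  "(\<And>s. x \<noteq> Inner e s) \<Longrightarrow> edge_green len x (edge_point G len e t) = 0"
  by (cases x) (auto simp: edge_point_def)

text \<open>On the vertices, a unit current entering inside an edge acts like the same current split
  between the two ends in the ratio of the interpolation weights.\<close>

definition source :: "('a, 'b) mg_point \<Rightarrow> 'a \<Rightarrow> real" where
  "source x p = interpolate G len (\<lambda>q. K q p) x"

text \<open>The potential of a unit current from x to the ground: linear along the edges, except for
  the kink that Green's function produces at x.\<close>

definition potential :: "('a, 'b) mg_point \<Rightarrow> ('a, 'b) mg_point \<Rightarrow> real" where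
  "potential x z = interpolate G len (source x) z + edge_green len x z"

lemma energy_source:
  assumes "x \<in> points G len"
  shows "dir (source x) \<phi> = interpolate G len \<phi> x - \<phi> ground"
proof (cases x)
  case (Vertex p)
  then have "source x = K p"
    by (simp add: source_def fun_eq_iff)
  then show ?thesis
    using Vertex assms energy_K by (auto simp: points_def)
next
  case (Inner e t)
  then have "e \<in> arcs G"
    using assms by (auto simp: points_def)
  then show ?thesis
    unfolding Inner source_def interpolate.simps energy_linear_left
    by (simp add: energy_K algebra_simps)
qed

lemma source_ground: "x \<in> points G len \<Longrightarrow> source x ground = 0"
  by (cases x) (auto simp: points_def source_def K_ground)

lemma potential_commute:
  assumes "x \<in> points G len" "z \<in> points G len"
  shows "potential x z = potential z x"
proof -
  have "interpolate G len (source x) z = dir (source z) (source x)"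
    using energy_source [OF assms(2)] source_ground [OF assms(1)] by simp
  also have "\<dots> = interpolate G len (source z) x"
    using energy_source [OF assms(1)] source_ground [OF assms(2)]
    by (simp add: energy_commute [of "arcs G" "tail G" "head G" len "source z" "source x"])
  finally show ?thesis
    by (simp add: potential_def edge_green_commute)
qed

context
  fixes P assumes finite_P: "finite P" and P_points: "P \<subseteq> points G len"
begin

lemma finite_cuts: "finite (cuts len P e)"
proof -
  have "{t. Inner e t \<in> P} = (\<lambda>t. Inner e t) -` P"
    by auto
  then show ?thesis
    using finite_vimageI [OF finite_P, of "\<lambda>t. Inner e t"] by (simp add: cuts_def inj_on_def)
qed

lemma cuts_subset: "e \<in> arcs G \<Longrightarrow> cuts len P e \<subseteq> {0..len e}"
  using len_pos [of e] P_points by (auto simp: cuts_def points_def)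

lemma Min_Max_cuts:
  assumes "e \<in> arcs G"
  shows "Min (cuts len P e) = 0" "Max (cuts len P e) = len e"
proof -
  show "Min (cuts len P e) = 0"
    using cuts_subset [OF assms] finite_cuts by (intro Min_eqI) (auto simp: cuts_def)
  show "Max (cuts len P e) = len e"
    using cuts_subset [OF assms] finite_cuts by (intro Max_eqI) (auto simp: cuts_def)
qed

lemma arcs_refine: "arcs (refine G len P) = (SIGMA e:arcs G. steps (cuts len P e))"
  by (auto simp: refine_def steps_def)

lemma fin_digraph_refine: "fin_digraph (refine G len P)"
proof
  show "finite (verts (refine G len P))"
    using finite_P by (simp add: refine_def)
  show "finite (arcs (refine G len P))"
    unfolding arcs_refine using finite_cuts finite_steps by auto
  have "edge_point G len e a \<in> verts (refine G len P)" if "e \<in> arcs G" "a \<in> cuts len P e" for e a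
    using that by (auto simp: refine_def edge_point_def cuts_def)
  then show "tail (refine G len P) a \<in> verts (refine G len P)"
      "head (refine G len P) a \<in> verts (refine G len P)" if "a \<in> arcs (refine G len P)" for a
    using that by (auto simp: refine_def)
qed

text \<open>On each edge the linear part telescopes to the edge term of \<open>source x\<close> in
  G, and the Green part yields \<open>\<phi> x\<close> minus its interpolation on the edge of x.
  This compensates the interpolated value in \<open>energy_source\<close>. Hence one function
  \<open>potential x\<close> serves all refinements containing x.\<close>

lemma energy_potential:
  assumes x: "x \<in> P"
  shows "energy (arcs (refine G len P)) (tail (refine G len P)) (head (refine G len P))
    segment_length (potential x) \<phi> = \<phi> x - \<phi> (Vertex ground)"
proof -
  have x_mem: "x \<in> points G len"
    using x P_points by auto
  define \<phi>' where "\<phi>' p = \<phi> (Vertex p)" for p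
  let ?F = "\<lambda>e t. potential x (edge_point G len e t)" and ?\<Phi> = "\<lambda>e t. \<phi> (edge_point G len e t)"
  let ?local = "\<lambda>e. case x of Inner e' s \<Rightarrow> if e' = e then \<phi> x - interpolate G len \<phi>' x else 0 | _ \<Rightarrow> 0"
  have edge: "(\<Sum>(a, b)\<in>steps (cuts len P e). (?F e b - ?F e a) * (?\<Phi> e b - ?\<Phi> e a) / (b - a))
      = (source x (tail G e) - source x (head G e)) * (\<phi>' (tail G e) - \<phi>' (head G e)) / len e + ?local e"
    if e: "e \<in> arcs G" for e
  proof -
    let ?C = "cuts len P e" and ?m = "(source x (head G e) - source x (tail G e)) / len e"
    let ?g = "\<lambda>t. edge_green len x (edge_point G len e t)"
    have C: "finite ?C" "?C \<noteq> {}" "Min ?C = 0" "Max ?C = len e"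
      using finite_cuts Min_Max_cuts [OF e] by (auto simp: cuts_def)
    have \<Phi>: "?\<Phi> e 0 = \<phi>' (tail G e)" "?\<Phi> e (len e) = \<phi>' (head G e)"
      using len_pos [OF e] by (simp_all add: edge_point_def \<phi>'_def)
    have F: "?F e b - ?F e a = ?m * (b - a) + (?g b - ?g a)" for a b
      using len_pos [OF e] by (simp add: potential_def interpolate_edge_point [OF e] field_simps)
    have "(\<Sum>(a, b)\<in>steps ?C. (?F e b - ?F e a) * (?\<Phi> e b - ?\<Phi> e a) / (b - a))
        = (\<Sum>(a, b)\<in>steps ?C. ?m * (?\<Phi> e b - ?\<Phi> e a) + (?g b - ?g a) * (?\<Phi> e b - ?\<Phi> e a) / (b - a))"
      unfolding F by (intro sum.cong) (auto simp: steps_def distrib_right add_divide_distrib)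
    also have "\<dots> = ?m * (\<Sum>(a, b)\<in>steps ?C. ?\<Phi> e b - ?\<Phi> e a)
        + (\<Sum>(a, b)\<in>steps ?C. (?g b - ?g a) * (?\<Phi> e b - ?\<Phi> e a) / (b - a))"
      unfolding sum_distrib_left sum.distrib [symmetric] by (simp add: case_prod_unfold)
    also have "(\<Sum>(a, b)\<in>steps ?C. ?\<Phi> e b - ?\<Phi> e a) = \<phi>' (head G e) - \<phi>' (tail G e)"
      using sum_steps [OF C(1,2), of "?\<Phi> e"] C \<Phi> by simp
    also have "(\<Sum>(a, b)\<in>steps ?C. (?g b - ?g a) * (?\<Phi> e b - ?\<Phi> e a) / (b - a)) = ?local e"
    proof (cases "\<exists>s. x = Inner e s")
      case True
      then obtain s where s: "x = Inner e s" "0 < s" "s < len e"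
        using x_mem by (auto simp: points_def)
      then have "s \<in> ?C" "edge_point G len e s = x"
        using x by (auto simp: cuts_def edge_point_def)
      then show ?thesis
        using sum_steps_green [OF C(1,3,4), of s "?\<Phi> e"] s \<Phi> len_pos [OF e]
        by (simp add: edge_green_edge_point_same)
    next
      case False
      then have "?g t = 0" for t
        by (intro edge_green_edge_point_other) auto
      then show ?thesis
        using False by (auto simp: case_prod_unfold split: mg_point.split)
    qed
    also have "?m * (\<phi>' (head G e) - \<phi>' (tail G e))
        = (source x (tail G e) - source x (head G e)) * (\<phi>' (tail G e) - \<phi>' (head G e)) / len e"
      by (simp add: algebra_simps diff_divide_distrib add_divide_distrib)
    finally show ?thesis .
  qed
  have "energy (arcs (refine G len P)) (tail (refine G len P)) (head (refine G len P))
        segment_length (potential x) \<phi>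
      = (\<Sum>e\<in>arcs G. \<Sum>(a, b)\<in>steps (cuts len P e). (?F e b - ?F e a) * (?\<Phi> e b - ?\<Phi> e a) / (b - a))"
    unfolding energy_def arcs_refine
    by (subst sum.Sigma) (auto simp: finite_cuts finite_steps refine_def segment_length_def
        case_prod_unfold algebra_simps intro!: sum.cong)
  also have "\<dots> = dir (source x) \<phi>' + (\<Sum>e\<in>arcs G. ?local e)"
    by (simp add: edge energy_def sum.distrib cong: sum.cong)
  also have "(\<Sum>e\<in>arcs G. ?local e) = \<phi> x - interpolate G len \<phi>' x"
    using x_mem by (cases x) (auto simp: points_def \<phi>'_def)
  finally show ?thesis
    by (simp add: energy_source [OF x_mem]) (simp add: \<phi>'_def)
qed

end

text \<open>By linearity, \<open>potential x\<close> minus \<open>potential y\<close> is a potential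
  for the unit current from x to y.\<close>

lemma resistance_eq:
  assumes x: "x \<in> points G len" and y: "y \<in> points G len"
  shows "resistance G len x y = potential x x - 2 * potential y x + potential y y"
proof -
  let ?P = "{x, y}" and ?f = "\<lambda>z. potential x z - potential y z"
  have P: "finite ?P" "?P \<subseteq> points G len"
    using x y by auto
  have "effective_resistance (refine G len ?P) segment_length x y = ?f x - ?f y"
  proof (intro effective_resistance_eq fin_digraph_refine P)
    show "x \<in> verts (refine G len ?P)" "y \<in> verts (refine G len ?P)"
      by (simp_all add: refine_def)
  qed (simp add: energy_diff_left energy_potential [OF P])
  then show ?thesis
    using potential_commute [OF x y] by (simp add: resistance_def)
qed

end

section \<open>The tau constant\<close>

lemma has_integral_affine_square:
  fixes p q a b :: real
  assumes "a \<le> b"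
  shows "((\<lambda>t. (p + q * t)\<^sup>2) has_integral
    (p\<^sup>2 * (b - a) + p * q * (b\<^sup>2 - a\<^sup>2) + q\<^sup>2 * (b ^ 3 - a ^ 3) / 3)) {a..b}"
proof -
  let ?F = "\<lambda>t. p\<^sup>2 * t + p * q * t\<^sup>2 + q\<^sup>2 * t ^ 3 / 3"
  have "((\<lambda>t. (p + q * t)\<^sup>2) has_integral (?F b - ?F a)) {a..b}"
  proof (rule fundamental_theorem_of_calculus [OF assms])
    fix t assume "t \<in> {a..b}"
    have "(?F has_real_derivative (p + q * t)\<^sup>2) (at t within {a..b})"
      by (auto intro!: derivative_eq_intros simp: field_simps power2_eq_square)
    then show "(?F has_vector_derivative (p + q * t)\<^sup>2) (at t within {a..b})"
      by (simp add: has_real_derivative_iff_has_vector_derivative)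
  qed
  moreover have "?F b - ?F a = p\<^sup>2 * (b - a) + p * q * (b\<^sup>2 - a\<^sup>2) + q\<^sup>2 * (b ^ 3 - a ^ 3) / 3"
    by (simp add: algebra_simps diff_divide_distrib)
  ultimately show ?thesis
    by simp
qed

text \<open>The integrals of the squared derivative on the two sides of a base point at s = u l.
  Here c is the mean slope of the vertex values, m is 1 - r / l with r the resistance across the
  edge, and the shifts by 1 - u and - u are the slopes of Green's function.\<close>

lemma two_affine_squares:
  fixes l s c m u q :: real
  assumes s: "s = u * l" and q: "q * l = - 2 * m"
  shows "(c + m - 2 * (1 - u))\<^sup>2 * (s - 0) + (c + m - 2 * (1 - u)) * q * (s\<^sup>2 - 0\<^sup>2)
        + q\<^sup>2 * (s ^ 3 - 0 ^ 3) / 3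
      + ((c + m - 2 * (- u))\<^sup>2 * (l - s) + (c + m - 2 * (- u)) * q * (l\<^sup>2 - s\<^sup>2)
        + q\<^sup>2 * (l ^ 3 - s ^ 3) / 3)
      = l * (c\<^sup>2 + m\<^sup>2 / 3 + 4 * u * (1 - u) * (1 - m))"
proof -
  have "q * l\<^sup>2 = (q * l) * l" "q\<^sup>2 * l ^ 3 = (q * l)\<^sup>2 * l" "q * s\<^sup>2 = (q * l) * l * u\<^sup>2"
      "q\<^sup>2 * s ^ 3 = (q * l)\<^sup>2 * l * u ^ 3"
    unfolding s by algebra+
  then have powers: "q * l\<^sup>2 = - 2 * m * l" "q\<^sup>2 * l ^ 3 = 4 * m\<^sup>2 * l" "q * s\<^sup>2 = - 2 * m * l * u\<^sup>2"
      "q\<^sup>2 * s ^ 3 = 4 * m\<^sup>2 * l * u ^ 3"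
    unfolding q by (simp_all add: power_mult_distrib)
  have "(c + m - 2 * (1 - u))\<^sup>2 * (s - 0) + (c + m - 2 * (1 - u)) * q * (s\<^sup>2 - 0\<^sup>2)
        + q\<^sup>2 * (s ^ 3 - 0 ^ 3) / 3
      + ((c + m - 2 * (- u))\<^sup>2 * (l - s) + (c + m - 2 * (- u)) * q * (l\<^sup>2 - s\<^sup>2)
        + q\<^sup>2 * (l ^ 3 - s ^ 3) / 3)
      = (c + m - 2 * (1 - u))\<^sup>2 * s + (c + m - 2 * (1 - u)) * (q * s\<^sup>2)
        + (c + m + 2 * u)\<^sup>2 * (l - s) + (c + m + 2 * u) * (q * l\<^sup>2 - q * s\<^sup>2) + q\<^sup>2 * l ^ 3 / 3"
    by (simp add: right_diff_distrib diff_divide_distrib)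
  also have "\<dots> = l * (c\<^sup>2 + m\<^sup>2 / 3 + 4 * u * (1 - u) * (1 - m))"
    unfolding powers unfolding s by (simp add: algebra_simps power2_eq_square power3_eq_cube)
  finally show ?thesis .
qed

section \<open>The squared derivative of the resistance along an edge\<close>

context metrized_network
begin

lemma source_edge_point:
  "e \<in> arcs G \<Longrightarrow> source (edge_point G len e t) p
    = (1 - t / len e) * K (tail G e) p + t / len e * K (head G e) p"
  by (simp add: source_def interpolate_edge_point)

text \<open>The vertex values of \<open>r(\<cdot>, y)\<close>, up to an additive constant.\<close>

definition profile :: "('a, 'b) mg_point \<Rightarrow> 'a \<Rightarrow> real" where
  "profile y p = diag p - 2 * source y p"

text \<open>The parabola has two sources: Green's function on the diagonal contributes
  \<open>len e\<close>, and the gap between the quadratic form of K and the interpolated diagonal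
  contributes \<open>- transfer e e\<close>.\<close>

lemma resistance_edge_point:
  assumes e: "e \<in> arcs G" and s: "0 \<le> s" "s \<le> len e" and y: "y \<in> points G len"
  shows "resistance G len (edge_point G len e s) y
    = profile y (tail G e) + (profile y (head G e) - profile y (tail G e)) * (s / len e)
      + (len e - transfer e e) * (s / len e * (1 - s / len e))
      - 2 * edge_green len y (edge_point G len e s) + potential y y"
proof -
  let ?x = "edge_point G len e s" and ?a = "tail G e" and ?b = "head G e"
  define u where "u = s / len e"
  have "edge_green len ?x ?x = s * (len e - s) / len e"
    using s by (auto simp: edge_point_def green_def)
  also have "\<dots> = len e * (u * (1 - u))"
    using len_pos [OF e] by (simp add: u_def field_simps)
  finally have pot_x: "potential ?x ?x = (1 - u) * ((1 - u) * K ?a ?a + u * K ?b ?a)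
      + u * ((1 - u) * K ?a ?b + u * K ?b ?b) + len e * (u * (1 - u))"
    unfolding potential_def interpolate_edge_point [OF e] source_edge_point [OF e]
    by (simp add: u_def)
  have K: "transfer e e = K ?a ?a + K ?b ?b - 2 * K ?a ?b" "K ?b ?a = K ?a ?b"
    using K_commute [OF tail_mem [OF e] head_mem [OF e]]
    by (simp_all add: transfer_def edge_potential_def)
  have pot_y: "potential y ?x = (1 - u) * source y ?a + u * source y ?b + edge_green len y ?x"
    by (simp add: potential_def interpolate_edge_point [OF e] u_def)
  show ?thesis
    unfolding resistance_eq [OF edge_point_mem [OF e s] y] u_def [symmetric] profile_def diag_def
      pot_x pot_y K
    by (simp add: algebra_simps)
qed

lemma deriv_resistance:
  assumes e: "e \<in> arcs G" and y: "y \<in> points G len" and ab: "0 \<le> a" "b \<le> len e" and t: "t \<in> {a<..<b}"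
    and green: "\<And>s. s \<in> {a<..<b} \<Longrightarrow> edge_green len y (edge_point G len e s) = j + k * s"
  shows "deriv (\<lambda>s. resistance G len (edge_point G len e s) y) t
    = (profile y (head G e) - profile y (tail G e)) / len e
      + (1 - transfer e e / len e) * (1 - 2 * t / len e) - 2 * k"
proof (rule DERIV_imp_deriv)
  let ?p = "\<lambda>s. profile y (tail G e) + (profile y (head G e) - profile y (tail G e)) * (s / len e)
      + (len e - transfer e e) * (s / len e * (1 - s / len e)) - 2 * (j + k * s) + potential y y"
  have "(?p has_real_derivative ((profile y (head G e) - profile y (tail G e)) / len e
      + (1 - transfer e e / len e) * (1 - 2 * t / len e) - 2 * k)) (at t)"
    using len_pos [OF e]
    by (auto intro!: derivative_eq_intros simp: field_simps power2_eq_square)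
  then show "((\<lambda>s. resistance G len (edge_point G len e s) y) has_real_derivative
      ((profile y (head G e) - profile y (tail G e)) / len e
        + (1 - transfer e e / len e) * (1 - 2 * t / len e) - 2 * k)) (at t)"
  proof (rule has_field_derivative_transform_within_open [where S = "{a<..<b}"])
    fix s assume "s \<in> {a<..<b}"
    then show "?p s = resistance G len (edge_point G len e s) y"
      using ab green [of s] by (subst resistance_edge_point [OF e _ _ y]) auto
  qed (use t in auto)
qed

lemma has_integral_deriv_resistance:
  assumes e: "e \<in> arcs G" and y: "y \<in> points G len" and ab: "0 \<le> a" "b \<le> len e" "a \<le> b"
    and green: "\<And>s. s \<in> {a<..<b} \<Longrightarrow> edge_green len y (edge_point G len e s) = j + k * s"
    and p: "p = (profile y (head G e) - profile y (tail G e)) / len e + (1 - transfer e e / len e) - 2 * k"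
    and q: "q = - 2 * (1 - transfer e e / len e) / len e"
  shows "((\<lambda>t. (deriv (\<lambda>s. resistance G len (edge_point G len e s) y) t)\<^sup>2) has_integral
    (p\<^sup>2 * (b - a) + p * q * (b\<^sup>2 - a\<^sup>2) + q\<^sup>2 * (b ^ 3 - a ^ 3) / 3)) {a..b}"
proof (rule has_integral_spike_finite [OF _ _ has_integral_affine_square [OF ab(3)]])
  show "finite {a, b}"
    by simp
  fix t assume "t \<in> {a..b} - {a, b}"
  then have "t \<in> {a<..<b}"
    by auto
  then have "deriv (\<lambda>s. resistance G len (edge_point G len e s) y) t = p + q * t"
    by (subst deriv_resistance [OF e y ab(1,2) _ green]) (simp_all add: p q algebra_simps diff_divide_distrib)
  then show "(deriv (\<lambda>s. resistance G len (edge_point G len e s) y) t)\<^sup>2 = (p + q * t)\<^sup>2"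
    by simp
qed

text \<open>A quarter of what a base point inside e adds to the integral over e, the rest being
  expressed by \<open>profile\<close>.\<close>

definition bend :: "('a, 'b) mg_point \<Rightarrow> 'b \<Rightarrow> real" where
  "bend y e = (case y of Inner e' s \<Rightarrow>
    if e' = e then s / len e * (1 - s / len e) * transfer e e else 0 | _ \<Rightarrow> 0)"

lemma integral_deriv_resistance:
  assumes e: "e \<in> arcs G" and y: "y \<in> points G len"
  shows "integral {0..len e} (\<lambda>t. (deriv (\<lambda>s. resistance G len (edge_point G len e s) y) t)\<^sup>2)
    = (profile y (tail G e) - profile y (head G e))\<^sup>2 / len e
      + (len e - 2 * transfer e e + (transfer e e)\<^sup>2 / len e) / 3 + 4 * bend y e"
proof -
  define l r D where "l = len e" and "r = transfer e e" and "D = profile y (head G e) - profile y (tail G e)"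
  have l: "0 < l"
    using len_pos [OF e] by (simp add: l_def)
  define q where "q = - 2 * (1 - r / l) / l"
  let ?f = "\<lambda>t. (deriv (\<lambda>s. resistance G len (edge_point G len e s) y) t)\<^sup>2"
  let ?I = "\<lambda>k a b. (D / l + (1 - r / l) - 2 * k)\<^sup>2 * (b - a)
      + (D / l + (1 - r / l) - 2 * k) * q * (b\<^sup>2 - a\<^sup>2) + q\<^sup>2 * (b ^ 3 - a ^ 3) / 3"
  have piece: "(?f has_integral ?I k a b) {a..b}"
    if "0 \<le> a" "a \<le> b" "b \<le> l" "\<And>s. s \<in> {a<..<b} \<Longrightarrow> edge_green len y (edge_point G len e s) = j + k * s"
    for a b j k
    using that(1,2,3) unfolding l_def r_def D_def q_def
    by (intro has_integral_deriv_resistance [OF e y _ _ _ that(4) refl refl])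
  have squares: "l * ((D / l)\<^sup>2 + (1 - r / l)\<^sup>2 / 3) = D\<^sup>2 / l + (l - 2 * r + r\<^sup>2 / l) / 3"
    using l by (simp add: field_simps power2_eq_square)
  have "integral {0..l} ?f = D\<^sup>2 / l + (l - 2 * r + r\<^sup>2 / l) / 3 + 4 * bend y e"
  proof (cases "\<exists>s. y = Inner e s")
    case True
    then obtain s where s: "y = Inner e s" "0 < s" "s < l"
      using y by (auto simp: points_def l_def)
    have green: "edge_green len y (edge_point G len e t) = green l s t" for t
      using s by (simp add: l_def edge_green_edge_point_same)
    have left: "edge_green len y (edge_point G len e t) = 0 + (1 - s / l) * t" if "t \<in> {0<..<s}" for t
      unfolding green using that l by (simp add: green_def field_simps)
    have right: "edge_green len y (edge_point G len e t) = s + - (s / l) * t" if "t \<in> {s<..<l}" for t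
      unfolding green using that l by (simp add: green_def field_simps)
    have "(?f has_integral (?I (1 - s / l) 0 s + ?I (- (s / l)) s l)) {0..l}"
    proof (rule has_integral_combine [of 0 s l])
      show "(?f has_integral ?I (1 - s / l) 0 s) {0..s}"
        by (rule piece [OF _ _ _ left]) (use s(2,3) in simp_all)
      show "(?f has_integral ?I (- (s / l)) s l) {s..l}"
        by (rule piece [OF _ _ _ right]) (use s(2,3) in simp_all)
    qed (use s(2,3) in simp_all)
    moreover have "?I (1 - s / l) 0 s + ?I (- (s / l)) s l
        = l * ((D / l)\<^sup>2 + (1 - r / l)\<^sup>2 / 3 + 4 * (s / l) * (1 - s / l) * (1 - (1 - r / l)))"
      by (rule two_affine_squares) (use l in \<open>simp_all add: q_def\<close>)
    ultimately have "(?f has_integral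
        l * ((D / l)\<^sup>2 + (1 - r / l)\<^sup>2 / 3 + 4 * (s / l) * (1 - s / l) * (1 - (1 - r / l)))) {0..l}"
      by (simp only:)
    then have "integral {0..l} ?f
        = l * ((D / l)\<^sup>2 + (1 - r / l)\<^sup>2 / 3) + l * (4 * (s / l) * (1 - s / l) * (1 - (1 - r / l)))"
      by (simp only: integral_unique distrib_left)
    moreover have "l * (4 * (s / l) * (1 - s / l) * (1 - (1 - r / l))) = 4 * bend y e"
      using l unfolding s(1) bend_def l_def [symmetric] r_def [symmetric] by simp
    ultimately show ?thesis
      by (simp only: squares)
  next
    case False
    then have green: "edge_green len y (edge_point G len e t) = 0 + 0 * t" for t
      by (subst edge_green_edge_point_other) auto
    have "(?f has_integral ?I 0 0 l) {0..l}"
      by (rule piece [OF _ _ _ green]) (use l in simp_all)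
    moreover have "?I 0 0 l = l * ((D / l)\<^sup>2 + (1 - r / l)\<^sup>2 / 3)"
      \<comment> \<open>The instance s = l, u = 1, in which the second piece is empty.\<close>
      using two_affine_squares [of l 1 l q "1 - r / l" "D / l"] l by (simp add: q_def)
    ultimately have "integral {0..l} ?f = l * ((D / l)\<^sup>2 + (1 - r / l)\<^sup>2 / 3)"
      by (simp only: integral_unique)
    moreover have "bend y e = 0"
      using False by (auto simp: bend_def split: mg_point.split)
    ultimately show ?thesis
      by (simp only: squares)
  qed
  then show ?thesis
    by (simp add: l_def r_def D_def power2_commute)
qed

text \<open>For y at fraction u of an edge, the quadratic form of K in the weights 1 - u and u falls
  short of the interpolated diagonal by u (1 - u) times the resistance across the edge.\<close>

lemma sum_bend:
  assumes "y \<in> points G len"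
  shows "(\<Sum>e\<in>arcs G. bend y e) = interpolate G len diag y - interpolate G len (source y) y"
proof (cases y)
  case (Vertex p)
  then show ?thesis
    by (simp add: bend_def diag_def source_def)
next
  case (Inner e s)
  then have e: "e \<in> arcs G"
    using assms by (auto simp: points_def)
  define u where "u = s / len e"
  have "(\<Sum>e'\<in>arcs G. bend y e') = u * (1 - u) * transfer e e"
    using e by (simp add: Inner bend_def u_def)
  also have "\<dots> = interpolate G len diag y - interpolate G len (source y) y"
    using K_commute [OF tail_mem [OF e] head_mem [OF e]]
    unfolding Inner interpolate.simps source_def diag_def transfer_def edge_potential_def u_def [symmetric]
    by (simp add: algebra_simps)
  finally show ?thesis .
qed

text \<open>The energy of \<open>profile y\<close> lacks four times the sum of the bends, and the
  integrals over the edges add the same amount, so the base point drops out.\<close>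

lemma tau_eq:
  assumes y: "y \<in> points G len"
  shows "tau G len y = (total_length G len - 2 * res_sum + res_square_sum) / 12 + diag_energy / 4"
proof -
  have "dir (profile y) (profile y) = diag_energy - 4 * dir (source y) diag + 4 * dir (source y) (source y)"
    unfolding profile_def [abs_def] energy_diff_scaled
    by (simp add: diag_energy_def energy_commute [of "arcs G" "tail G" "head G" len diag "source y"])
  also have "\<dots> = diag_energy - 4 * (\<Sum>e\<in>arcs G. bend y e)"
    using energy_source [OF y] source_ground [OF y] K_ground [OF ground_mem]
    by (simp add: sum_bend [OF y] diag_def)
  finally have profile: "dir (profile y) (profile y) = diag_energy - 4 * (\<Sum>e\<in>arcs G. bend y e)" .
  have "4 * tau G len y = (\<Sum>e\<in>arcs G. (profile y (tail G e) - profile y (head G e))\<^sup>2 / len e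
      + (len e - 2 * transfer e e + (transfer e e)\<^sup>2 / len e) / 3 + 4 * bend y e)"
    by (simp add: tau_def integral_deriv_resistance y)
  also have "\<dots> = (\<Sum>e\<in>arcs G. (profile y (tail G e) - profile y (head G e))\<^sup>2 / len e)
      + (\<Sum>e\<in>arcs G. len e - 2 * transfer e e + (transfer e e)\<^sup>2 / len e) / 3
      + 4 * (\<Sum>e\<in>arcs G. bend y e)"
    by (simp only: sum.distrib [symmetric] sum_divide_distrib sum_distrib_left)
  also have "(\<Sum>e\<in>arcs G. len e - 2 * transfer e e + (transfer e e)\<^sup>2 / len e)
      = total_length G len - 2 * res_sum + res_square_sum"
    unfolding total_length_def res_sum_def res_square_sum_def sum.distrib sum_subtractf sum_distrib_left ..
  also have "(\<Sum>e\<in>arcs G. (profile y (tail G e) - profile y (head G e))\<^sup>2 / len e)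
      = dir (profile y) (profile y)"
    by (simp add: energy_def power2_eq_square)
  finally show ?thesis
    unfolding profile by simp
qed

end

section \<open>Edge connectivity and the lower bounds\<close>

lemma connected_cut:
  assumes conn: "Digraph_Component.connected H" and X: "X \<subseteq> verts H" "X \<noteq> {}" "X \<noteq> verts H"
  shows "\<exists>e\<in>arcs H. (tail H e \<in> X) \<noteq> (head H e \<in> X)"
proof (rule ccontr)
  assume "\<not> ?thesis"
  then have closed: "y \<in> X" if "x \<rightarrow>\<^bsub>with_proj (mk_symmetric H)\<^esub> y" "x \<in> X" for x y
    using that by (auto simp: parcs_mk_symmetric)
  obtain u w where u: "u \<in> X" and w: "w \<in> verts H" "w \<notin> X"
    using X by blast
  have "u \<rightarrow>\<^sup>*\<^bsub>with_proj (mk_symmetric H)\<^esub> w"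
    using conn u w X(1) unfolding Digraph_Component.connected_def strongly_connected_def
    by (simp add: subset_iff)
  then have "w \<in> X"
    unfolding reachable_def by (induction rule: rtrancl_on_induct) (use u closed in auto)
  with w show False
    by simp
qed

context metrized_graph
begin

text \<open>Deleting the edges of a cut disconnects the graph by \<open>connected_cut\<close>, so
  every cut competes in the infimum.\<close>

lemma edge_connected_edge_connectivity:
  assumes "enat n \<le> edge_connectivity G"
  shows "edge_connected (arcs G) (verts G) (tail G) (head G) n"
  unfolding edge_connected_def
proof (intro allI impI, elim conjE)
  fix X assume X: "X \<subseteq> verts G" "X \<noteq> {}" "X \<noteq> verts G"
  let ?F = "{e\<in>arcs G. (tail G e \<in> X) \<noteq> (head G e \<in> X)}"
  have "\<not> Digraph_Component.connected (G\<lparr>arcs := arcs G - ?F\<rparr>)"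
  proof
    assume "Digraph_Component.connected (G\<lparr>arcs := arcs G - ?F\<rparr>)"
    from connected_cut [OF this, of X] X show False
      by simp
  qed
  moreover have "?F \<subseteq> arcs G" "finite ?F"
    by auto
  ultimately have "edge_connectivity G \<le> enat (card ?F)"
    unfolding edge_connectivity_def by (intro Inf_lower CollectI exI [of _ ?F] conjI refl)
  then show "n \<le> card ?F"
    using order_trans [OF assms] enat_ord_simps(1) by blast
qed

lemma edge_connected_1: "edge_connected (arcs G) (verts G) (tail G) (head G) 1"
  unfolding edge_connected_def
proof (intro allI impI, elim conjE)
  fix X assume "X \<subseteq> verts G" "X \<noteq> {}" "X \<noteq> verts G"
  then have "{e\<in>arcs G. (tail G e \<in> X) \<noteq> (head G e \<in> X)} \<noteq> {}"
    using connected_cut [OF connected_graph] by blast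
  then show "1 \<le> card {e\<in>arcs G. (tail G e \<in> X) \<noteq> (head G e \<in> X)}"
    by (simp add: Suc_le_eq card_gt_0_iff)
qed

lemma metrized_network_exists: "\<exists>ground K. metrized_network G len ground K"
proof -
  obtain ground where "ground \<in> verts G"
    using connected_graph by (auto simp: Digraph_Component.connected_def strongly_connected_def)
  then obtain K where "grounded_network (arcs G) (verts G) (tail G) (head G) len ground K"
    using grounded_network_exists [of "arcs G" "verts G" ground "tail G" "head G" len,
        OF finite_arcs finite_verts _ _ _ len_pos edge_connected_1] by auto
  then have "metrized_network G len ground K"
    by (intro metrized_network.intro metrized_graph_axioms)
  then show ?thesis
    by blast
qed

end

section \<open>Minimising the quadratic lower bound for \<tau>\<close>

text \<open>
  For \<open>b = s\<^sup>2 / l\<close> and \<open>d = 2 b / v\<close>, the value of \<open>\<tau>\<close> as a function of \<open>s\<close> is minimal at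
  \<open>s = l v / (v + 6)\<close>; the last assumption keeps \<open>s\<close> below \<open>4 / n\<close> times this value.
\<close>

lemma tau_bounds_arith:
  fixes l s b d \<tau> v :: real
  assumes \<tau>: "\<tau> = (l - 2 * s + b) / 12 + d / 4"
    and d: "2 * b \<le> v * d" and b: "s\<^sup>2 \<le> l * b" and v: "1 \<le> v" and l: "0 \<le> l" and s: "0 \<le> s" and "0 \<le> b"
  shows "l / (2 * (v + 6)) \<le> \<tau>"
    and "\<lbrakk>4 \<le> n; n * ((b + 3 * d) / 4) \<le> s\<rbrakk> \<Longrightarrow>
      l * (1 / 12 * (1 - 4 / n)\<^sup>2 + 4 * (n - 2) / ((v + 6) * n\<^sup>2)) \<le> \<tau>"
proof -
  have "b / (2 * v) \<le> d / 4"
    using d v by (simp add: field_simps)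
  then have \<tau>_ge: "l / 12 - s / 6 + (v + 6) / (12 * v) * b \<le> \<tau>"
    using v by (simp add: \<tau> field_simps)
  \<comment> \<open>The quadratic in s / l decreases up to its vertex v / (v + 6). So s may be
    replaced by l x if x lies between s / l and the vertex, or is the vertex itself.\<close>
  have key: "l / 12 - s / 6 + (v + 6) / (12 * v) * b
      \<ge> l / 12 - l * x / 6 + (v + 6) / (12 * v) * (l * x\<^sup>2)"
    if x: "s \<le> l * x \<and> x \<le> v / (v + 6) \<or> x = v / (v + 6)" for x
  proof (cases "l = 0")
    case True
    then show ?thesis
      using b \<open>0 \<le> b\<close> v by simp
  next
    case False
    then have "0 < l"
      using l by simp
    define z where "z = s / l"
    have z: "s = l * z"
      using \<open>0 < l\<close> by (simp add: z_def)
    have "l * z\<^sup>2 \<le> b"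
      using b \<open>0 < l\<close> unfolding z by (simp add: power2_eq_square mult.left_commute)
    then have "(v + 6) / (12 * v) * (l * z\<^sup>2) \<le> (v + 6) / (12 * v) * b"
      using v by (intro mult_left_mono) auto
    \<comment> \<open>The value at z minus the value at x, factored by means of the vertex v / (v +
      6).\<close>
    moreover have "0 \<le> l * ((v + 6) / (12 * v) * ((x - z) * (2 * (v / (v + 6)) - x - z)))"
    proof -
      have "0 \<le> (x - z) * (2 * (v / (v + 6)) - x - z)"
        using x
      proof
        assume *: "s \<le> l * x \<and> x \<le> v / (v + 6)"
        then have "z \<le> x"
          using \<open>0 < l\<close> by (simp add: z)
        then show ?thesis
          using * by (intro mult_nonneg_nonneg) auto
      next
        assume "x = v / (v + 6)"
        then have "(x - z) * (2 * (v / (v + 6)) - x - z) = (x - z)\<^sup>2"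
          by (simp add: power2_eq_square)
        then show ?thesis
          by simp
      qed
      then show ?thesis
        using \<open>0 < l\<close> v
        by (intro mult_nonneg_nonneg [of l] mult_nonneg_nonneg [of "(v + 6) / (12 * v)"]) simp_all
    qed
    moreover have "l * ((v + 6) / (12 * v) * ((x - z) * (2 * (v / (v + 6)) - x - z)))
        = l * (x - z) / 6 - (v + 6) / (12 * v) * (l * x\<^sup>2) + (v + 6) / (12 * v) * (l * z\<^sup>2)"
    proof -
      have w: "(v + 6) / (12 * v) * (2 * (v / (v + 6))) = 1 / 6"
        using v by (simp add: divide_simps)
      have expand: "l * (c * ((x - z) * (w - x - z))) = l * (x - z) * (c * w) - c * (l * x\<^sup>2) + c * (l * z\<^sup>2)"
        for c w :: real
        by (simp add: algebra_simps power2_eq_square)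
      show ?thesis
        unfolding expand w by simp
    qed
    moreover have "l * (x - z) / 6 = l * x / 6 - l * z / 6"
      by (simp add: right_diff_distrib diff_divide_distrib)
    ultimately show ?thesis
      unfolding z by linarith
  qed
  have factor: "l / 12 - l * x / 6 + c * (l * x\<^sup>2) = l * (1 / 12 - x / 6 + c * x\<^sup>2)" for c x
    by (simp add: algebra_simps)
  show "l / (2 * (v + 6)) \<le> \<tau>"
  proof -
    have "1 / 12 - x / 6 + (v + 6) / (12 * v) * x\<^sup>2 = 1 / (2 * (v + 6))" if x: "x = v / (v + 6)" for x
    proof -
      have "(v + 6) / (12 * v) * x = 1 / 12"
        using v by (simp add: x divide_simps)
      then have "(v + 6) / (12 * v) * x\<^sup>2 = x / 12"
        by (simp only: power2_eq_square mult.assoc [symmetric])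
      moreover have "x = 1 - 12 * (1 / (2 * (v + 6)))"
        using v by (simp add: x divide_simps)
      ultimately show ?thesis
        by linarith
    qed
    then have "l / 12 - l * (v / (v + 6)) / 6 + (v + 6) / (12 * v) * (l * (v / (v + 6))\<^sup>2)
        = l * (1 / (2 * (v + 6)))"
      unfolding factor by metis
    moreover have "l / 12 - l * (v / (v + 6)) / 6 + (v + 6) / (12 * v) * (l * (v / (v + 6))\<^sup>2) \<le> \<tau>"
      using key [of "v / (v + 6)"] \<tau>_ge by linarith
    ultimately show ?thesis
      by simp
  qed
  assume n: "4 \<le> n" and q: "n * ((b + 3 * d) / 4) \<le> s"
  \<comment> \<open>The bound on s / l forced by the connectivity: the hypotheses turn q into b
    \<le> s x, and the Cauchy-Schwarz bound then gives s \<le> l x. For n \<ge> 4 it does not exceed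
    the vertex v / (v + 6).\<close>
  define x where "x = 4 * v / ((v + 6) * n)"
  have "(v + 6) / v * b \<le> b + 3 * d"
    using d v by (simp add: field_simps)
  then have "n * ((v + 6) / v * b / 4) \<le> n * ((b + 3 * d) / 4)"
    using n by (intro mult_left_mono) auto
  then have "n * ((v + 6) / v * b / 4) \<le> s"
    using q by linarith
  then have "b * ((v + 6) * n) \<le> s * (4 * v)"
    using v by (simp add: field_simps)
  moreover have "0 < (v + 6) * n"
    using n v by simp
  ultimately have bs: "b \<le> s * x"
    unfolding x_def times_divide_eq_right by (simp only: pos_le_divide_eq)
  have "s \<le> l * x"
  proof (cases "s = 0")
    case True
    then show ?thesis
      using l n v by (simp add: x_def)
  next
    case False
    have "s\<^sup>2 \<le> l * (s * x)"
      using b bs l by (meson mult_left_mono order_trans)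
    then show ?thesis
      using False s by (simp add: power2_eq_square)
  qed
  moreover have "4 / n * (v / (v + 6)) \<le> 1 * (v / (v + 6))"
    using n v by (intro mult_right_mono) simp_all
  then have "x \<le> v / (v + 6)"
    by (simp add: x_def mult.commute)
  ultimately have "l / 12 - l * x / 6 + (v + 6) / (12 * v) * (l * x\<^sup>2) \<le> \<tau>"
    using key [of x] \<tau>_ge by linarith
  moreover have "1 / 12 * (1 - 4 / n)\<^sup>2 + 4 * (n - 2) / ((v + 6) * n\<^sup>2)
      = 1 / 12 - x / 6 + (v + 6) / (12 * v) * x\<^sup>2"
  proof -
    define a i where "a = 1 / n" and "i = 1 / (v + 6)"
    have "(v + 6) / (12 * v) * x = a / 3"
      using n v by (simp add: x_def a_def divide_simps)
    then have square: "(v + 6) / (12 * v) * x\<^sup>2 = a / 3 * x"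
      by (simp only: power2_eq_square mult.assoc [symmetric])
    have x: "x = 4 * a * (1 - 6 * i)"
      using n v by (simp add: x_def a_def i_def field_simps)
    have last: "4 * (n - 2) / ((v + 6) * n\<^sup>2) = 4 * i * (a - 2 * a\<^sup>2)"
      using n v by (simp add: a_def i_def field_simps power2_eq_square)
    have first: "4 / n = 4 * a"
      by (simp add: a_def)
    show ?thesis
      unfolding square last first unfolding x by (simp add: field_simps power2_eq_square)
  qed
  ultimately show "l * (1 / 12 * (1 - 4 / n)\<^sup>2 + 4 * (n - 2) / ((v + 6) * n\<^sup>2)) \<le> \<tau>"
    by (simp only: factor)
qed

text \<open>Here n is any lower bound for the edge connectivity, so n = 6 serves all values from 6
  on, including \<infinity>.\<close>

lemma (in metrized_graph) tau_lower_bounds: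
  assumes y: "y \<in> points G len"
  shows "total_length G len / (2 * (real (card (verts G)) + 6)) \<le> tau G len y"
    and "\<lbrakk>4 \<le> n; enat n \<le> edge_connectivity G\<rbrakk> \<Longrightarrow>
      total_length G len * (1 / 12 * (1 - 4 / real n)\<^sup>2
        + 4 * (real n - 2) / ((real (card (verts G)) + 6) * (real n)\<^sup>2)) \<le> tau G len y"
proof -
  obtain ground K where "metrized_network G len ground K"
    using metrized_network_exists by blast
  then interpret N: metrized_network G len ground K .
  have card: "1 \<le> real (card (verts G))"
    using N.ground_mem by (simp add: Suc_le_eq card_gt_0_iff) blast
  have nonneg: "0 \<le> total_length G len" "0 \<le> N.res_sum" "0 \<le> N.res_square_sum"
    unfolding total_length_def N.res_sum_def N.res_square_sum_def
    by (auto intro!: sum_nonneg simp: N.transfer_self_nonneg len_pos less_imp_le)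
  note bounds = tau_bounds_arith [OF N.tau_eq [OF y] N.diag_energy_ge
      N.res_sum_square_le [folded total_length_def] card nonneg]
  show "total_length G len / (2 * (real (card (verts G)) + 6)) \<le> tau G len y"
    by (rule bounds(1))
  assume n: "4 \<le> n" "enat n \<le> edge_connectivity G"
  have "real n * N.cut_mass \<le> N.res_sum"
    using cut_mass_le [OF N.grounded_network_axioms edge_connected_edge_connectivity [OF n(2)]] .
  then show "total_length G len * (1 / 12 * (1 - 4 / real n)\<^sup>2
      + 4 * (real n - 2) / ((real (card (verts G)) + 6) * (real n)\<^sup>2)) \<le> tau G len y"
    using n(1) by (intro bounds(2)) (simp_all add: N.cut_mass_def)
qed

theorem theorem6p10:
  fixes G :: "('a, 'b) pre_digraph" and len :: "'b \<Rightarrow> real" and y :: "('a, 'b) mg_point"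
  assumes "metrized_graph G len"
    and "y \<in> points G len"
  shows
    "(\<forall>\<Lambda>::nat. edge_connectivity G = enat \<Lambda> \<and> \<Lambda> \<ge> 4 \<longrightarrow>
        tau G len y \<ge> total_length G len *
          (1 / 12 * (1 - 4 / real \<Lambda>)\<^sup>2 +
           4 * (real \<Lambda> - 2) / ((real (card (verts G)) + 6) * (real \<Lambda>)\<^sup>2))) \<and>
     (edge_connectivity G \<ge> 6 \<longrightarrow> tau G len y \<ge> total_length G len / 108) \<and>
     (edge_connectivity G = 5 \<longrightarrow> tau G len y \<ge> total_length G len / 300) \<and>
     tau G len y \<ge> total_length G len / (2 * (real (card (verts G)) + 6)) \<and>
     (card (verts G) \<le> 48 \<longrightarrow> tau G len y \<ge> total_length G len / 108)"
proof -
  interpret metrized_graph G len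
    by fact
  note bounds = tau_lower_bounds [OF assms(2)]
  let ?v = "real (card (verts G))"
  have nonneg: "0 \<le> total_length G len"
    unfolding total_length_def by (intro sum_nonneg) (simp add: len_pos less_imp_le)
  \<comment> \<open>Drop the nonnegative second summand; the first equals 1/108 for n = 6 and 1/300
    for n = 5.\<close>
  have weaken: "total_length G len * c \<le> tau G len y"
    if "4 \<le> n" "enat n \<le> edge_connectivity G" "c \<le> 1 / 12 * (1 - 4 / real n)\<^sup>2" for n c
  proof -
    have "c \<le> 1 / 12 * (1 - 4 / real n)\<^sup>2 + 4 * (real n - 2) / ((?v + 6) * (real n)\<^sup>2)"
      using that by (intro add_increasing2) auto
    then show ?thesis
      using bounds(2) [OF that(1,2)] nonneg by (meson mult_left_mono order_trans)
  qed
  have "total_length G len / 108 \<le> tau G len y" if "6 \<le> edge_connectivity G"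
    using weaken [of 6 "1 / 108"] that by (simp add: power2_eq_square numeral_eq_enat)
  moreover have "total_length G len / 300 \<le> tau G len y" if "edge_connectivity G = 5"
    using weaken [of 5 "1 / 300"] that by (simp add: power2_eq_square numeral_eq_enat)
  moreover have "total_length G len / 108 \<le> tau G len y" if "card (verts G) \<le> 48"
  proof -
    \<comment> \<open>At v = 48 the denominator 2 (v + 6) is exactly 108.\<close>
    have "total_length G len / 108 \<le> total_length G len / (2 * (?v + 6))"
      using that nonneg by (intro divide_left_mono) auto
    then show ?thesis
      using bounds(1) by linarith
  qed
  ultimately show ?thesis
    using bounds by auto
qed

end
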